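(* Let $\mathbb{F}$ be a field and $n$ a positive integer. Let $u$ and $v$ be reduced locally nilpotent linear representations of the cyclic quiver $\mathcal{C}_n$ over $\mathbb{F}$ with countable dimension. Then $u$ and $v$ are isomorphic if and only if $\kappa_{k,\alpha}(u)=\kappa_{k,\alpha}(v)$ for all $k \in \mathbb{Z}/n$ and all $\alpha \in \omega_1$.
   Context: $\omega_1$ is the first uncountable ordinal (the set of all countable ordinals). "Countable" means of cardinality at most $\aleph_0$. A linear representation of $\mathcal{C}_n$ (an $n$-cycle of linear mappings) is a family $u=(U_k,u_k)_{k\in\mathbb{Z}/n}$ where each $U_k$ is an $\mathbb{F}$-vector space and $u_k:U_k\to U_{k+1}$ is linear. Its dimension is $\sum_k \dim U_k$. An isomorphism from $(U_k,u_k)_k$ to $(V_k,v_k)_k$ is a family of linear isomorphisms $\varphi_k:U_k\to V_k$ ($k\in\mathbb{Z}/n$) with $v_k\circ\varphi_k=\varphi_{k+1}\circ u_k$ for all $k$. Put $(\pi u)_k:=u_{k+n-1}\circ\cdots\circ u_{k+1}\circ u_k$, an endomorphism of $U_k$. The representation $u$ is locally nilpotent if for every $x\in U_0$ there is an integer $i\ge 0$ with $((\pi u)_0)^i(x)=0$ (equivalently, the same holds for every $k$ in place of $0$). For every ordinal $\alpha$ and $k\in\mathbb{Z}/n$ define linear subspaces $U_{k,\alpha}$ of $U_k$ by transfinite induction: $U_{k,0}:=U_k$; $U_{k,\alpha+1}:=u_{k-1}(U_{k-1,\alpha})$; $U_{k,\alpha}:=\bigcap_{\beta<\alpha}U_{k,\beta}$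 for $\alpha$ a limit ordinal. These are non-increasing in $\alpha$. Put $U_{k,\infty}:=\bigcap_\alpha U_{k,\alpha}$ (over all ordinals). $u$ is reduced if $U_{k,\infty}=\{0\}$ for all $k$. The map $u_k$ induces a surjective linear map $u_{k,\alpha}:U_{k,\alpha}/U_{k,\alpha+1}\to U_{k+1,\alpha+1}/U_{k+1,\alpha+2}$, and the $(k,\alpha)$-th (cyclic) Kaplansky invariant is the cardinal $\kappa_{k,\alpha}(u):=\dim(\ker u_{k,\alpha})$. *)

theory Defs
  imports "Jordan_Normal_Form.Missing_VectorSpace" "HOL-Algebra.QuotRing"
begin

unbundle cardinal_syntax

section \<open>Dimension and quotients of vector spaces\<close>

text \<open>
  The dimension as a cardinal. (The library constant \<^const>\<open>vectorspace.dim\<close> is a natural number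
  and does not measure infinite-dimensional spaces.) Cardinals are compared with \<open>=o\<close> and \<open>\<le>o\<close>.
\<close>

definition vdim :: "('f, 'm) ring_scheme \<Rightarrow> ('f, 'a, 'p) module_scheme \<Rightarrow> 'a rel" where
  "vdim K V = |SOME B. vectorspace.basis K V B|"

text \<open>
  The quotient space \<open>V / W\<close>, whose vectors are the cosets of \<open>W\<close>; compare \<^const>\<open>FactRing\<close>.
  The fields \<open>mult\<close> and \<open>one\<close> of a module record carry no meaning.
\<close>

definition quot_space :: "('f, 'a, 'p) module_scheme \<Rightarrow> 'a set \<Rightarrow> ('f, 'a set) module" where
  "quot_space V W =
    \<lparr>carrier = a_rcosets\<^bsub>V\<^esub> W, mult = (\<lambda>_ _. W), one = W, zero = W, add = set_add V,
     smult = (\<lambda>c X. \<Union>x\<in>X. W +>\<^bsub>V\<^esub> (c \<odot>\<^bsub>V\<^esub> x))\<rparr>"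

text \<open>
  The map that \<open>f\<close> induces from a quotient space to \<open>V' / W'\<close>. If \<open>f\<close> maps the subspace that is
  factored out on the left into \<open>W'\<close>, the sets in the union are all equal.
\<close>

definition quot_map :: "('f, 'b, 'q) module_scheme \<Rightarrow> 'b set \<Rightarrow> ('a \<Rightarrow> 'b) \<Rightarrow> 'a set \<Rightarrow> 'b set" where
  "quot_map V' W' f X = (\<Union>x\<in>X. W' +>\<^bsub>V'\<^esub> f x)"

section \<open>Representations of the cyclic quiver\<close>

text \<open>
  The elements of \<open>\<int>/n\<close> are represented by the natural numbers below \<open>n\<close>. Taking all vectors from
  one type \<open>'a\<close> is no restriction: the spaces are arbitrary (unrelated) module structures with
  carriers in \<open>'a\<close>, so a sum type can serve as \<open>'a\<close>. Only the values of the two fields at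
  \<open>k < n\<close>, and of \<open>arrow u k\<close> on the carrier of \<open>space_at u k\<close>, matter.
\<close>

record ('f, 'a) cyc_rep =
  space_at :: "nat \<Rightarrow> ('f, 'a) module"
  arrow :: "nat \<Rightarrow> 'a \<Rightarrow> 'a"

definition cnext :: "nat \<Rightarrow> nat \<Rightarrow> nat" where
  "cnext n k = (k + 1) mod n"

definition cprev :: "nat \<Rightarrow> nat \<Rightarrow> nat" where
  "cprev n k = (k + n - 1) mod n"

definition cyclic_rep :: "('f, 'm) ring_scheme \<Rightarrow> nat \<Rightarrow> ('f, 'a) cyc_rep \<Rightarrow> bool" where
  "cyclic_rep K n u \<longleftrightarrow>
    (\<forall>k<n. vectorspace K (space_at u k)
         \<and> linear_map K (space_at u k) (space_at u (cnext n k)) (arrow u k))"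

definition rep_dim :: "('f, 'm) ring_scheme \<Rightarrow> nat \<Rightarrow> ('f, 'a) cyc_rep \<Rightarrow> (nat \<times> 'a) rel" where
  "rep_dim K n u = (CSUM k : |{..<n}|. vdim K (space_at u k))"

definition isomorphic_reps ::
    "('f, 'm) ring_scheme \<Rightarrow> nat \<Rightarrow> ('f, 'a) cyc_rep \<Rightarrow> ('f, 'b) cyc_rep \<Rightarrow> bool" where
  "isomorphic_reps K n u v \<longleftrightarrow>
    (\<exists>\<phi> :: nat \<Rightarrow> 'a \<Rightarrow> 'b. \<forall>k<n.
        linear_map K (space_at u k) (space_at v k) (\<phi> k)
      \<and> bij_betw (\<phi> k) (carrier (space_at u k)) (carrier (space_at v k))
      \<and> (\<forall>x\<in>carrier (space_at u k). arrow v k (\<phi> k x) = \<phi> (cnext n k) (arrow u k x)))"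

text \<open>\<open>arrow_path n u k m\<close> is the composite of the \<open>m\<close> consecutive arrows that start at vertex \<open>k\<close>.\<close>

primrec arrow_path :: "nat \<Rightarrow> ('f, 'a) cyc_rep \<Rightarrow> nat \<Rightarrow> nat \<Rightarrow> 'a \<Rightarrow> 'a" where
  "arrow_path n u k 0 = id"
| "arrow_path n u k (Suc m) = arrow u ((k + m) mod n) \<circ> arrow_path n u k m"

definition cycle_map :: "nat \<Rightarrow> ('f, 'a) cyc_rep \<Rightarrow> nat \<Rightarrow> 'a \<Rightarrow> 'a" where
  "cycle_map n u k = arrow_path n u k n"

definition locally_nilpotent :: "nat \<Rightarrow> ('f, 'a) cyc_rep \<Rightarrow> bool" where
  "locally_nilpotent n u \<longleftrightarrow>
    (\<forall>x\<in>carrier (space_at u 0). \<exists>i. (cycle_map n u 0 ^^ i) x = \<zero>\<^bsub>space_at u 0\<^esub>)"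

section \<open>The transfinite filtration and the Kaplansky invariants\<close>

text \<open>
  Ordinals are the elements \<open>\<alpha>\<close> of the field of a well-order \<open>r\<close>, where \<open>\<alpha>\<close> stands for the order
  type of \<open>underS r \<alpha>\<close>.
\<close>

definition ord_succ :: "'o rel \<Rightarrow> 'o \<Rightarrow> 'o" where
  "ord_succ r \<alpha> = wo_rel.suc r {\<alpha>}"

definition filt_step ::
    "nat \<Rightarrow> ('f, 'a) cyc_rep \<Rightarrow> 'o rel \<Rightarrow> ('o \<Rightarrow> nat \<Rightarrow> 'a set) \<Rightarrow> 'o \<Rightarrow> nat \<Rightarrow> 'a set" where
  "filt_step n u r S \<alpha> k =
    (if underS r \<alpha> = {} then carrier (space_at u k)
     else if \<exists>\<beta>\<in>underS r \<alpha>. \<alpha> = ord_succ r \<beta>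
     then let \<beta> = (THE \<beta>. \<beta> \<in> underS r \<alpha> \<and> \<alpha> = ord_succ r \<beta>)
          in arrow u (cprev n k) ` S \<beta> (cprev n k)
     else (\<Inter>\<beta>\<in>underS r \<alpha>. S \<beta> k))"

definition filt :: "nat \<Rightarrow> ('f, 'a) cyc_rep \<Rightarrow> 'o rel \<Rightarrow> 'o \<Rightarrow> nat \<Rightarrow> 'a set" where
  "filt n u r = wo_rel.worec r (filt_step n u r)"

lemma ord_succ_inject:
  assumes r: "Well_order r" and "\<beta> \<in> underS r \<alpha>" "\<gamma> \<in> underS r \<alpha>"
    and "\<alpha> = ord_succ r \<beta>" "\<alpha> = ord_succ r \<gamma>"
  shows "\<beta> = \<gamma>"
proof -
  have *: False if "\<beta> \<in> underS r \<alpha>" "\<gamma> \<in> underS r \<alpha>" "\<alpha> = ord_succ r \<beta>" "\<alpha> = ord_succ r \<gamma>"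
    "(\<beta>, \<gamma>) \<in> r" "\<beta> \<noteq> \<gamma>" for \<beta> \<gamma>
  proof -
    have "\<gamma> \<in> AboveS r {\<beta>}" using that by (auto simp: AboveS_def Field_def)
    then have "(wo_rel.suc r {\<beta>}, \<gamma>) \<in> r"
      using r by (intro wo_rel.suc_least_AboveS) (simp_all add: wo_rel_def)
    then have "(\<alpha>, \<gamma>) \<in> r" using that by (simp add: ord_succ_def)
    moreover have "(\<gamma>, \<alpha>) \<in> r" "\<gamma> \<noteq> \<alpha>" using that by (auto simp: underS_def)
    moreover have "antisym r" using r wo_rel.ANTISYM wo_rel_def by blast
    ultimately show False by (auto simp: antisym_def)
  qed
  have "\<beta> \<in> Field r" "\<gamma> \<in> Field r" using assms by (auto simp: underS_def Field_def)
  then have "(\<beta>, \<gamma>) \<in> r \<or> (\<gamma>, \<beta>) \<in> r" using r wo_rel.TOTALS wo_rel_def by blast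
  then show ?thesis using *[of \<beta> \<gamma>] *[of \<gamma> \<beta>] assms by argo
qed

lemma filt_step_succ:
  assumes "Well_order r" "\<beta> \<in> underS r \<alpha>" "\<alpha> = ord_succ r \<beta>"
  shows "filt_step n u r S \<alpha> k = arrow u (cprev n k) ` S \<beta> (cprev n k)"
proof -
  have "(THE \<beta>. \<beta> \<in> underS r \<alpha> \<and> \<alpha> = ord_succ r \<beta>) = \<beta>"
    using assms ord_succ_inject[OF assms(1)] by (intro the_equality conjI) (simp_all, metis)
  moreover have "\<exists>\<beta>\<in>underS r \<alpha>. \<alpha> = ord_succ r \<beta>" "underS r \<alpha> \<noteq> {}"
    using assms by blast+
  ultimately show ?thesis by (simp add: filt_step_def)
qed

text \<open>
  The defining equations of the filtration:
  \<open>U\<^sub>k\<^sub>,\<^sub>0 = U\<^sub>k\<close>, \<open>U\<^sub>k\<^sub>,\<^sub>\<alpha>\<^sub>+\<^sub>1 = u\<^sub>k\<^sub>-\<^sub>1(U\<^sub>k\<^sub>-\<^sub>1\<^sub>,\<^sub>\<alpha>)\<close>, and intersections at limit ordinals.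
\<close>

lemma filt_unfold:
  assumes r: "Well_order r"
  shows "filt n u r \<alpha> = filt_step n u r (filt n u r) \<alpha>"
proof -
  have wo: "wo_rel r" using r by (simp add: wo_rel_def)
  have "filt_step n u r f x k = filt_step n u r g x k"
    if eq: "\<forall>y\<in>underS r x. f y = g y" for f g x k
  proof (cases "\<exists>\<beta>\<in>underS r x. x = ord_succ r \<beta>")
    case True
    then obtain \<beta> where "\<beta> \<in> underS r x" "x = ord_succ r \<beta>" by blast
    then show ?thesis using eq by (simp add: filt_step_succ[OF r, of \<beta>] del: bex_simps)
  next
    case False
    then show ?thesis using eq by (auto simp: filt_step_def)
  qed
  then have "wo_rel.adm_wo r (filt_step n u r)"
    unfolding wo_rel.adm_wo_def[OF wo] by blast
  from wo_rel.worec_fixpoint[OF wo this] show ?thesis unfolding filt_def by metis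
qed

lemma filt_zero:
  assumes "Well_order r" "underS r \<alpha> = {}"
  shows "filt n u r \<alpha> k = carrier (space_at u k)"
  using assms by (subst filt_unfold) (simp_all add: filt_step_def)

lemma filt_succ:
  assumes r: "Well_order r" and "(\<alpha>, \<beta>) \<in> r" "\<alpha> \<noteq> \<beta>"
  shows "filt n u r (ord_succ r \<alpha>) k = arrow u (cprev n k) ` filt n u r \<alpha> (cprev n k)"
proof -
  have "AboveS r {\<alpha>} \<noteq> {}" "{\<alpha>} \<subseteq> Field r"
    using assms by (auto simp: AboveS_def Field_def)
  then have "\<alpha> \<in> underS r (ord_succ r \<alpha>)"
    using wo_rel.suc_greater[of r "{\<alpha>}" \<alpha>] r
    by (auto simp: ord_succ_def underS_def wo_rel_def)
  then show ?thesis
    by (subst filt_unfold[OF r]) (simp add: filt_step_succ[OF r])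
qed

lemma filt_limit:
  assumes "Well_order r" "underS r \<alpha> \<noteq> {}" "\<And>\<beta>. \<beta> \<in> underS r \<alpha> \<Longrightarrow> \<alpha> \<noteq> ord_succ r \<beta>"
  shows "filt n u r \<alpha> k = (\<Inter>\<beta>\<in>underS r \<alpha>. filt n u r \<beta> k)"
  using assms by (subst filt_unfold) (auto simp: filt_step_def)

text \<open>
  The intersection over all ordinals is taken over all ordinals that are represented in well-orders
  on the type \<open>(nat \<times> 'a) set\<close>. These are enough: whenever the filtration has not become
  stationary at \<open>\<alpha>\<close>, some \<open>(k, x)\<close> with \<open>k < n\<close> has \<open>x\<close> in \<open>U\<^sub>k\<^sub>,\<^sub>\<alpha>\<close> but not in \<open>U\<^sub>k\<^sub>,\<^sub>\<alpha>\<^sub>+\<^sub>1\<close>, so that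
  it becomes stationary at an ordinal of cardinality at most that of \<open>nat \<times> 'a\<close>, and a well-order
  of the (strictly larger) type \<open>(nat \<times> 'a) set\<close> is longer than that.
\<close>

definition filt_inf :: "nat \<Rightarrow> ('f, 'a) cyc_rep \<Rightarrow> nat \<Rightarrow> 'a set" where
  "filt_inf n u k =
    \<Inter> {filt n u r \<alpha> k | (r :: (nat \<times> 'a) set rel) \<alpha>. Well_order r \<and> \<alpha> \<in> Field r}"

definition reduced_rep :: "nat \<Rightarrow> ('f, 'a) cyc_rep \<Rightarrow> bool" where
  "reduced_rep n u \<longleftrightarrow> (\<forall>k<n. filt_inf n u k = {\<zero>\<^bsub>space_at u k\<^esub>})"

definition filt_quot ::
    "nat \<Rightarrow> ('f, 'a) cyc_rep \<Rightarrow> 'o rel \<Rightarrow> nat \<Rightarrow> 'o \<Rightarrow> ('f, 'a set) module" where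
  "filt_quot n u r k \<alpha> =
    quot_space (space_at u k\<lparr>carrier := filt n u r \<alpha> k\<rparr>) (filt n u r (ord_succ r \<alpha>) k)"

definition induced_arrow ::
    "nat \<Rightarrow> ('f, 'a) cyc_rep \<Rightarrow> 'o rel \<Rightarrow> nat \<Rightarrow> 'o \<Rightarrow> 'a set \<Rightarrow> 'a set" where
  "induced_arrow n u r k \<alpha> =
    quot_map (space_at u (cnext n k)\<lparr>carrier := filt n u r (ord_succ r \<alpha>) (cnext n k)\<rparr>)
      (filt n u r (ord_succ r (ord_succ r \<alpha>)) (cnext n k)) (arrow u k)"

text \<open>The well-order \<open>r\<close> is meant to have no greatest element, so that \<open>\<alpha> + 1\<close> and \<open>\<alpha> + 2\<close> exist.\<close>

definition kaplansky_inv ::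
    "('f, 'm) ring_scheme \<Rightarrow> nat \<Rightarrow> ('f, 'a) cyc_rep \<Rightarrow> 'o rel \<Rightarrow> nat \<Rightarrow> 'o \<Rightarrow> 'a set rel" where
  "kaplansky_inv K n u r k \<alpha> =
    vdim K (filt_quot n u r k \<alpha>
      \<lparr>carrier := a_kernel (filt_quot n u r k \<alpha>) (filt_quot n u r (cnext n k) (ord_succ r \<alpha>))
         (induced_arrow n u r k \<alpha>)\<rparr>)"

text \<open>
  The first uncountable ordinal, as a well-order: its field with the induced order is a copy of
  the set of all countable ordinals.
\<close>

definition omega1 :: "nat set rel" where
  "omega1 = cardSuc natLeq"

end

theory Submission
  imports Defs "HOL-Library.Countable_Set_Type"
begin

text \<open>
  Equal Kaplansky invariants give an isomorphism by Ulm's back-and-forth argument. The height of a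
  vector is its position in the filtration. A linear correspondence between subrepresentations that
  preserves heights and takes only finitely many of them is extended to a further vector \<open>x\<close> whose
  image under the arrow is already in its domain: replace \<open>x\<close> by an element \<open>w\<close> of its coset that has
  maximal height \<open>a\<close>, and whose image, if possible, has height more than \<open>a + 1\<close>. If there is no such
  jump, any preimage at level \<open>a\<close> of the required image can be the partner of \<open>w\<close>; otherwise \<open>w\<close>
  represents a class in the kernel counted by the Kaplansky invariant. Instead of counting
  dimensions, an isomorphism of these kernels is fixed in advance for every vertex and level, and the
  correspondence is required to induce it. Local nilpotence reduces every vector to such one-step
  extensions. Countable dimension makes the enumeration possible, and it also makes the
  filtration stationary, hence zero by reducedness, before \<open>\<omega>\<^sub>1\<close>.
\<close>

text \<open>Heights alone do not determine a partner for \<open>w\<close>. The arrow must send it to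
  a prescribed \<open>z\<close>, and it must stay at height \<open>a\<close> whatever element of the
  range is added. If some sum \<open>y + t\<close> falls into level \<open>a + 1\<close>, then its
  counterpart \<open>w + s\<close> has its image in level \<open>a + 2\<close>; so trouble arises
  only from such jumps, and their classes modulo level \<open>a + 1\<close> are what the Kaplansky
  invariant counts. The field is arbitrary, so the spaces may be uncountable as sets. The
  enumeration therefore runs through bases. What the correspondences keep is finiteness of the set
  of heights, because it gives every coset an element of maximal height.\<close>

lemma linear_mapI:
  assumes "vectorspace K V" "vectorspace K W"
    and "\<And>x. x \<in> carrier V \<Longrightarrow> T x \<in> carrier W"
    and "\<And>x y. x \<in> carrier V \<Longrightarrow> y \<in> carrier V \<Longrightarrow> T (x \<oplus>\<^bsub>V\<^esub> y) = T x \<oplus>\<^bsub>W\<^esub> T y"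
    and "\<And>c x. c \<in> carrier K \<Longrightarrow> x \<in> carrier V \<Longrightarrow> T (c \<odot>\<^bsub>V\<^esub> x) = c \<odot>\<^bsub>W\<^esub> T x"
  shows "linear_map K V W T"
  using assms
  by (auto simp: linear_map_def mod_hom_def mod_hom_axioms_def module_hom_def vectorspace_def)

section \<open>Linear relations\<close>

text \<open>Relations instead of maps make the two directions of the back-and-forth exchangeable by
  taking converses. They can be many-valued, as \<open>\<Theta> a k\<close> can; single-valuedness
  is derived where a map is wanted.\<close>

definition linear_relation ::
    "('f, 'm) ring_scheme \<Rightarrow> ('f, 'a, 'p) module_scheme \<Rightarrow> ('f, 'b, 'q) module_scheme \<Rightarrow> ('a \<times> 'b) set \<Rightarrow> bool"
  where "linear_relation K V W G \<longleftrightarrow>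
    G \<subseteq> carrier V \<times> carrier W \<and> (\<zero>\<^bsub>V\<^esub>, \<zero>\<^bsub>W\<^esub>) \<in> G \<and>
    (\<forall>x y x' y'. (x, y) \<in> G \<longrightarrow> (x', y') \<in> G \<longrightarrow> (x \<oplus>\<^bsub>V\<^esub> x', y \<oplus>\<^bsub>W\<^esub> y') \<in> G) \<and>
    (\<forall>c x y. c \<in> carrier K \<longrightarrow> (x, y) \<in> G \<longrightarrow> (c \<odot>\<^bsub>V\<^esub> x, c \<odot>\<^bsub>W\<^esub> y) \<in> G)"

lemma linear_relation_carrier:
  assumes "linear_relation K V W G" "(x, y) \<in> G"
  shows "x \<in> carrier V" "y \<in> carrier W"
  using assms by (auto simp: linear_relation_def)

lemma linear_relation_zero: "linear_relation K V W G \<Longrightarrow> (\<zero>\<^bsub>V\<^esub>, \<zero>\<^bsub>W\<^esub>) \<in> G"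
  by (auto simp: linear_relation_def)

lemma linear_relation_add:
  "linear_relation K V W G \<Longrightarrow> (x, y) \<in> G \<Longrightarrow> (x', y') \<in> G \<Longrightarrow> (x \<oplus>\<^bsub>V\<^esub> x', y \<oplus>\<^bsub>W\<^esub> y') \<in> G"
  by (auto simp: linear_relation_def)

lemma linear_relation_smult:
  "linear_relation K V W G \<Longrightarrow> c \<in> carrier K \<Longrightarrow> (x, y) \<in> G \<Longrightarrow> (c \<odot>\<^bsub>V\<^esub> x, c \<odot>\<^bsub>W\<^esub> y) \<in> G"
  by (auto simp: linear_relation_def)

lemma linear_relation_converse: "linear_relation K V W G \<Longrightarrow> linear_relation K W V (G\<inverse>)"
  by (auto simp: linear_relation_def)

lemma linear_relation_minus:
  assumes "vectorspace K V" "vectorspace K W" "linear_relation K V W G" "(x, y) \<in> G" "(x', y') \<in> G"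
  shows "(x \<ominus>\<^bsub>V\<^esub> x', y \<ominus>\<^bsub>W\<^esub> y') \<in> G"
proof -
  interpret V: vectorspace K V by fact
  interpret W: vectorspace K W by fact
  have "x' \<in> carrier V" "y' \<in> carrier W" using linear_relation_carrier[OF assms(3,5)] by auto
  then show ?thesis
    using linear_relation_add[OF assms(3,4) linear_relation_smult[OF assms(3) _ assms(5), of "\<ominus>\<^bsub>K\<^esub> \<one>\<^bsub>K\<^esub>"]]
    by (simp add: V.smult_minus_1 W.smult_minus_1 a_minus_def)
qed

text \<open>Applied to differences of pairs, the condition on zero makes the relation single-valued
  and injective at once. All isomorphisms constructed below come from such a relation.\<close>

lemma linear_relation_bij:
  assumes V: "vectorspace K V" and W: "vectorspace K W" and G: "linear_relation K V W G"
    and dom: "\<And>x. x \<in> carrier V \<Longrightarrow> \<exists>y. (x, y) \<in> G"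
    and ran: "\<And>y. y \<in> carrier W \<Longrightarrow> \<exists>x. (x, y) \<in> G"
    and zero: "\<And>x y. (x, y) \<in> G \<Longrightarrow> x = \<zero>\<^bsub>V\<^esub> \<longleftrightarrow> y = \<zero>\<^bsub>W\<^esub>"
  obtains T where "linear_map K V W T" "bij_betw T (carrier V) (carrier W)"
    "\<And>x y. (x, y) \<in> G \<longleftrightarrow> x \<in> carrier V \<and> y = T x"
proof -
  interpret V: vectorspace K V by fact
  interpret W: vectorspace K W by fact
  have uniq: "x = x' \<longleftrightarrow> y = y'" if "(x, y) \<in> G" "(x', y') \<in> G" for x y x' y'
  proof -
    note c = linear_relation_carrier[OF G that(1)] linear_relation_carrier[OF G that(2)]
    have "x \<ominus>\<^bsub>V\<^esub> x' = \<zero>\<^bsub>V\<^esub> \<longleftrightarrow> y \<ominus>\<^bsub>W\<^esub> y' = \<zero>\<^bsub>W\<^esub>"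
      using zero linear_relation_minus[OF V W G that] by blast
    then show ?thesis using c by simp
  qed
  define T where "T x = (SOME y. (x, y) \<in> G)" for x
  have T: "(x, T x) \<in> G" if "x \<in> carrier V" for x
    unfolding T_def by (rule someI_ex) (rule dom[OF that])
  have iff: "(x, y) \<in> G \<longleftrightarrow> x \<in> carrier V \<and> y = T x" for x y
    using T uniq linear_relation_carrier(1)[OF G] by blast
  have "linear_map K V W T"
  proof (rule linear_mapI[OF V W])
    show "T x \<in> carrier W" if "x \<in> carrier V" for x
      using T[OF that] linear_relation_carrier[OF G] by blast
    show "T (x \<oplus>\<^bsub>V\<^esub> y) = T x \<oplus>\<^bsub>W\<^esub> T y" if "x \<in> carrier V" "y \<in> carrier V" for x y
      using linear_relation_add[OF G T T, of x y] that iff by simp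
    show "T (c \<odot>\<^bsub>V\<^esub> x) = c \<odot>\<^bsub>W\<^esub> T x" if "c \<in> carrier K" "x \<in> carrier V" for c x
      using linear_relation_smult[OF G _ T, of c x] that iff by simp
  qed
  moreover have "bij_betw T (carrier V) (carrier W)"
  proof (rule bij_betw_imageI)
    show "inj_on T (carrier V)"
      by (rule inj_onI) (use uniq[OF T T] in simp)
    show "T ` carrier V = carrier W"
    proof
      show "T ` carrier V \<subseteq> carrier W" using T linear_relation_carrier(2)[OF G] by blast
      show "carrier W \<subseteq> T ` carrier V" using ran iff by blast
    qed
  qed
  ultimately show thesis using iff that by blast
qed

section \<open>Bases and dimension\<close>

context vectorspace
begin

text \<open>Zorn's lemma applies because a linear dependence involves only finitely many vectors,
  which already lie in one member of a chain. A maximal independent set generates.\<close>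

lemma basis_exists: "\<exists>B. basis B"
proof -
  let ?P = "\<lambda>S. S \<subseteq> carrier V \<and> lin_indpt S"
  have "\<exists>M\<in>Collect ?P. \<forall>X\<in>Collect ?P. M \<subseteq> X \<longrightarrow> X = M"
  proof (rule subset_Zorn')
    fix C assume C: "subset.chain (Collect ?P) C"
    have "lin_indpt (\<Union>C)"
    proof
      assume "lin_dep (\<Union>C)"
      then obtain A a v where A: "finite A" "A \<subseteq> \<Union>C" "a \<in> A \<rightarrow> carrier K" "lincomb a A = \<zero>\<^bsub>V\<^esub>"
        "v \<in> A" "a v \<noteq> \<zero>\<^bsub>K\<^esub>" unfolding lin_dep_def by blast
      then have "C \<noteq> {}" by blast
      then obtain S where "S \<in> C" "A \<subseteq> S"
        using finite_subset_Union_chain[OF A(1,2) _ C] by blast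
      moreover have "lin_dep S" using A \<open>A \<subseteq> S\<close> unfolding lin_dep_def by blast
      ultimately show False using C unfolding subset.chain_def by blast
    qed
    moreover have "\<Union>C \<subseteq> carrier V" using C by (auto simp: subset.chain_def)
    ultimately show "\<Union>C \<in> Collect ?P" by blast
  qed
  then obtain B where B: "?P B" "\<forall>X\<in>Collect ?P. B \<subseteq> X \<longrightarrow> X = B" by (elim bexE CollectE)
  then have "maximal B ?P" unfolding maximal_def by blast
  then have "gen_set B" by (rule max_li_is_gen)
  with B(1) have "basis B" unfolding basis_def by blast
  then show ?thesis ..
qed

text \<open>Each vector of \<open>B\<close> needs only finitely many vectors of \<open>L\<close>,
  and these finite sets together cover \<open>L\<close>: a vector \<open>l\<close> left out would
  lie in the span of the others. A union of \<open>|B|\<close> finite sets is no larger than the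
  infinite \<open>B\<close>.\<close>

lemma basis_card_le:
  assumes L: "basis L" and B: "basis B" and inf: "infinite B"
  shows "|L| \<le>o |B|"
proof -
  have Lc: "L \<subseteq> carrier V" "lin_indpt L" "span L = carrier V" using L unfolding basis_def by auto
  have Bc: "B \<subseteq> carrier V" "span B = carrier V" using B unfolding basis_def by auto
  have "\<exists>S. finite S \<and> S \<subseteq> L \<and> b \<in> span S" if "b \<in> B" for b
  proof -
    have "b \<in> span L" using Lc(3) Bc(1) that by blast
    then obtain a A where A: "finite A" "A \<subseteq> L" "a \<in> A \<rightarrow> carrier K" "b = lincomb a A"
      unfolding span_def by blast
    then have "b \<in> span A" unfolding span_def by blast
    then show ?thesis using A by blast
  qed
  then obtain S where S: "\<And>b. b \<in> B \<Longrightarrow> finite (S b) \<and> S b \<subseteq> L \<and> b \<in> span (S b)" by metis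
  have "L \<subseteq> (\<Union>b\<in>B. S b)"
  proof
    fix l assume l: "l \<in> L"
    show "l \<in> (\<Union>b\<in>B. S b)"
    proof (rule ccontr)
      assume n: "l \<notin> (\<Union>b\<in>B. S b)"
      have sub: "L - {l} \<subseteq> carrier V" using Lc(1) by blast
      have "B \<subseteq> span (L - {l})"
      proof
        fix b assume "b \<in> B"
        then have "S b \<subseteq> L - {l}" "b \<in> span (S b)" using S n by auto
        then show "b \<in> span (L - {l})" using span_is_monotone by blast
      qed
      then have "span B \<subseteq> span (L - {l})"
        using span_is_subset span_is_submodule[OF sub] by blast
      then have "l \<in> span (L - {l})" using Bc(2) l Lc(1) by blast
      moreover have "lin_indpt (L - {l})" by (rule subset_li_is_li[OF Lc(2)]) blast
      ultimately have "lin_dep ((L - {l}) \<union> {l})"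
        using lin_dep_iff_in_span[OF sub, of l] l Lc(1) by blast
      moreover have "(L - {l}) \<union> {l} = L" using l by auto
      ultimately show False using Lc(2) by (simp only: not_True_eq_False)
    qed
  qed
  then have "|L| \<le>o |\<Union>b\<in>B. S b|" by (rule card_of_mono1)
  moreover have "|S b| \<le>o |B|" if "b \<in> B" for b
    using S[OF that] inf ordLeq_total[OF card_of_Well_order card_of_Well_order, of "S b" B]
      card_of_ordLeq_finite[of B "S b"] by argo
  then have "|\<Union>b\<in>B. S b| \<le>o |B|"
    using card_of_mono1[OF order.refl] by (intro card_of_UNION_ordLeq_infinite[OF inf] ballI) auto
  ultimately show ?thesis by (rule ordLeq_transitive)
qed

text \<open>This makes \<open>vdim\<close>, which is defined through a chosen basis, independent of
  the choice.\<close>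

lemma basis_card_eq:
  assumes L: "basis L" and B: "basis B"
  shows "|L| =o |B|"
proof -
  have fin: "finite X" if "basis X" "basis Y" "finite Y" for X Y
  proof -
    have X: "lin_indpt X" "X \<subseteq> carrier V" and Y: "gen_set Y" "Y \<subseteq> carrier V"
      using that(1,2) unfolding basis_def by auto
    have "fin_dim" unfolding fin_dim_def using Y that(3) by blast
    then show ?thesis using X by (rule fin_dim_li_fin)
  qed
  show ?thesis
  proof (cases "finite L")
    case True
    moreover have "finite B" by (rule fin[OF B L True])
    moreover have "card L = card B"
      using dim_basis[OF True L] dim_basis[OF \<open>finite B\<close> B] by (rule trans[OF sym])
    ultimately obtain h where "bij_betw h L B" using finite_same_card_bij by blast
    then show ?thesis using card_of_ordIso by blast
  next
    case False
    then have "infinite B" using fin[OF L B] by blast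
    then show ?thesis using False basis_card_le[OF L B] basis_card_le[OF B L] ordIso_iff_ordLeq by blast
  qed
qed

lemma basis_vdim:
  assumes "basis B"
  shows "vdim K V =o |B|"
  unfolding vdim_def by (rule basis_card_eq[OF someI[of basis, OF assms] assms])

text \<open>Padding with zero coefficients brings two linear combinations over a common index set,
  where they can be added.\<close>

lemma finsum_smult_extend:
  assumes "finite C" "A \<subseteq> C" "a \<in> A \<rightarrow> carrier K" "g \<in> C \<rightarrow> carrier V"
  shows "(\<Oplus>\<^bsub>V\<^esub>x\<in>A. a x \<odot>\<^bsub>V\<^esub> g x) = (\<Oplus>\<^bsub>V\<^esub>x\<in>C. (if x \<in> A then a x else \<zero>\<^bsub>K\<^esub>) \<odot>\<^bsub>V\<^esub> g x)"
  using assms by (intro add.finprod_mono_neutral_cong_left) (auto simp: Pi_iff)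

end

text \<open>The graph of the isomorphism is written down directly: combinations of basis vectors
  paired with the combinations of their images that have the same coefficients. Independence on both
  sides yields the condition on zero.\<close>

lemma bij_betw_linear_iso_on_bases:
  assumes V: "vectorspace K V" and W: "vectorspace K W"
    and B: "vectorspace.basis K V B" and C: "vectorspace.basis K W C" and f: "bij_betw f B C"
  obtains T where "linear_map K V W T" "bij_betw T (carrier V) (carrier W)"
proof -
  interpret V: vectorspace K V by fact
  interpret W: vectorspace K W by fact
  define comb where "comb a A = (V.lincomb a A, \<Oplus>\<^bsub>W\<^esub>b\<in>A. a b \<odot>\<^bsub>W\<^esub> f b)" for a A
  define G where "G = {comb a A | a A. finite A \<and> A \<subseteq> B \<and> a \<in> A \<rightarrow> carrier K}"
  have Bc: "B \<subseteq> carrier V" "V.lin_indpt B" "V.span B = carrier V" using B unfolding V.basis_def by auto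
  have Cc: "C \<subseteq> carrier W" "W.lin_indpt C" "W.span C = carrier W" using C unfolding W.basis_def by auto
  have fB: "f b \<in> carrier W" "f b \<in> C" if "b \<in> B" for b using f Cc that unfolding bij_betw_def by auto
  have cl: "V.lincomb a A \<in> carrier V" "(\<Oplus>\<^bsub>W\<^esub>b\<in>A. a b \<odot>\<^bsub>W\<^esub> f b) \<in> carrier W"
    if "finite A" "A \<subseteq> B" "a \<in> A \<rightarrow> carrier K" for a A
    using that Bc(1) fB by (auto intro!: W.finsum_closed simp: Pi_iff subset_iff)
  have ext: "comb a A = comb (\<lambda>x. if x \<in> A then a x else \<zero>\<^bsub>K\<^esub>) D"
    if "finite D" "D \<subseteq> B" "A \<subseteq> D" "a \<in> A \<rightarrow> carrier K" for a A D
    using that Bc(1) fB V.finsum_smult_extend[of D A a id] W.finsum_smult_extend[of D A a f]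
    by (auto simp: comb_def V.lincomb_def Pi_iff subset_iff)
  have G: "linear_relation K V W G"
    unfolding linear_relation_def
  proof (intro conjI allI impI)
    show "G \<subseteq> carrier V \<times> carrier W" unfolding G_def comb_def using cl by auto
    have "comb (\<lambda>_. \<zero>\<^bsub>K\<^esub>) {} = (\<zero>\<^bsub>V\<^esub>, \<zero>\<^bsub>W\<^esub>)" by (simp add: comb_def)
    then show "(\<zero>\<^bsub>V\<^esub>, \<zero>\<^bsub>W\<^esub>) \<in> G"
      unfolding G_def by (intro CollectI exI[of _ "\<lambda>_. \<zero>\<^bsub>K\<^esub>"] exI[of _ "{}"]) auto
  next
    fix x y x' y' assume "(x, y) \<in> G" "(x', y') \<in> G"
    then obtain a A a' A' where A: "finite A" "A \<subseteq> B" "a \<in> A \<rightarrow> carrier K" "(x, y) = comb a A"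
      and A': "finite A'" "A' \<subseteq> B" "a' \<in> A' \<rightarrow> carrier K" "(x', y') = comb a' A'"
      unfolding G_def by blast
    define D where "D = A \<union> A'"
    define b where "b x = (if x \<in> A then a x else \<zero>\<^bsub>K\<^esub>)" for x
    define b' where "b' x = (if x \<in> A' then a' x else \<zero>\<^bsub>K\<^esub>)" for x
    have D: "finite D" "D \<subseteq> B" "b \<in> D \<rightarrow> carrier K" "b' \<in> D \<rightarrow> carrier K"
      using A A' by (auto simp: D_def b_def b'_def)
    have e: "(x, y) = comb b D" "(x', y') = comb b' D"
      using ext[of D A a] ext[of D A' a'] A A' D unfolding D_def b_def b'_def by auto
    have "V.lincomb (\<lambda>v. b v \<oplus>\<^bsub>K\<^esub> b' v) D = V.lincomb b D \<oplus>\<^bsub>V\<^esub> V.lincomb b' D"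
      using D Bc by (intro V.lincomb_sum) auto
    moreover have "(\<Oplus>\<^bsub>W\<^esub>v\<in>D. (b v \<oplus>\<^bsub>K\<^esub> b' v) \<odot>\<^bsub>W\<^esub> f v) = (\<Oplus>\<^bsub>W\<^esub>v\<in>D. b v \<odot>\<^bsub>W\<^esub> f v \<oplus>\<^bsub>W\<^esub> b' v \<odot>\<^bsub>W\<^esub> f v)"
      using D fB by (intro W.finsum_cong') (auto simp: Pi_iff subset_iff W.smult_l_distr)
    moreover have "\<dots> = (\<Oplus>\<^bsub>W\<^esub>v\<in>D. b v \<odot>\<^bsub>W\<^esub> f v) \<oplus>\<^bsub>W\<^esub> (\<Oplus>\<^bsub>W\<^esub>v\<in>D. b' v \<odot>\<^bsub>W\<^esub> f v)"
      using D fB by (intro W.finsum_addf) (auto simp: Pi_iff subset_iff)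
    ultimately have "(x \<oplus>\<^bsub>V\<^esub> x', y \<oplus>\<^bsub>W\<^esub> y') = comb (\<lambda>v. b v \<oplus>\<^bsub>K\<^esub> b' v) D"
      using e unfolding comb_def by simp
    moreover have "(\<lambda>v. b v \<oplus>\<^bsub>K\<^esub> b' v) \<in> D \<rightarrow> carrier K" using D by (auto simp: Pi_iff)
    ultimately show "(x \<oplus>\<^bsub>V\<^esub> x', y \<oplus>\<^bsub>W\<^esub> y') \<in> G" unfolding G_def using D by blast
  next
    fix c x y assume c: "c \<in> carrier K" and "(x, y) \<in> G"
    then obtain a A where A: "finite A" "A \<subseteq> B" "a \<in> A \<rightarrow> carrier K" "(x, y) = comb a A"
      unfolding G_def by blast
    have "V.lincomb (\<lambda>w. c \<otimes>\<^bsub>K\<^esub> a w) A = c \<odot>\<^bsub>V\<^esub> V.lincomb a A"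
      using A Bc c by (intro V.lincomb_smult) auto
    moreover have "(\<Oplus>\<^bsub>W\<^esub>v\<in>A. (c \<otimes>\<^bsub>K\<^esub> a v) \<odot>\<^bsub>W\<^esub> f v) = (\<Oplus>\<^bsub>W\<^esub>v\<in>A. c \<odot>\<^bsub>W\<^esub> (a v \<odot>\<^bsub>W\<^esub> f v))"
      using A fB c by (intro W.finsum_cong') (auto simp: Pi_iff subset_iff W.smult_assoc1)
    moreover have "\<dots> = c \<odot>\<^bsub>W\<^esub> (\<Oplus>\<^bsub>W\<^esub>v\<in>A. a v \<odot>\<^bsub>W\<^esub> f v)"
      using A fB c by (intro W.finsum_smult[symmetric]) (auto simp: Pi_iff subset_iff)
    ultimately have "(c \<odot>\<^bsub>V\<^esub> x, c \<odot>\<^bsub>W\<^esub> y) = comb (\<lambda>w. c \<otimes>\<^bsub>K\<^esub> a w) A"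
      using A unfolding comb_def by simp
    moreover have "(\<lambda>w. c \<otimes>\<^bsub>K\<^esub> a w) \<in> A \<rightarrow> carrier K" using A c by (auto simp: Pi_iff)
    ultimately show "(c \<odot>\<^bsub>V\<^esub> x, c \<odot>\<^bsub>W\<^esub> y) \<in> G" unfolding G_def using A by blast
  qed
  define g where "g = inv_into B f"
  have g: "g c \<in> B" "f (g c) = c" if "c \<in> C" for c
    using f that unfolding g_def bij_betw_def by (auto intro: inv_into_into f_inv_into_f)
  have gf: "g (f b) = b" if "b \<in> B" for b
    using f that unfolding g_def bij_betw_def by (auto intro: inv_into_f_f)
  \<comment> \<open>Independence and span of \<open>C\<close> speak of combinations over subsets of
    \<open>C\<close>; hence the reindexing along \<open>f\<close>, with the coefficients carried
    over by its inverse \<open>g\<close>.\<close>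
  have comb2: "snd (comb a A) = W.lincomb (a \<circ> g) (f ` A)"
    if "finite A" "A \<subseteq> B" "a \<in> A \<rightarrow> carrier K" for a A
  proof -
    have inj: "inj_on f A" using f that(2) unfolding bij_betw_def by (blast intro: inj_on_subset)
    have "W.lincomb (a \<circ> g) (f ` A) = (\<Oplus>\<^bsub>W\<^esub>b\<in>A. (a \<circ> g) (f b) \<odot>\<^bsub>W\<^esub> f b)"
      unfolding W.lincomb_def using that gf fB inj
      by (intro W.finsum_reindex) (auto simp: Pi_iff subset_iff)
    also have "\<dots> = (\<Oplus>\<^bsub>W\<^esub>b\<in>A. a b \<odot>\<^bsub>W\<^esub> f b)"
      using that gf fB by (intro W.finsum_cong') (auto simp: Pi_iff subset_iff)
    finally show ?thesis by (simp add: comb_def)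
  qed
  show thesis
  proof (rule linear_relation_bij[OF V W G])
    fix x assume "x \<in> carrier V"
    then have "x \<in> V.span B" using Bc by simp
    then show "\<exists>y. (x, y) \<in> G" unfolding V.span_def G_def comb_def by blast
  next
    fix y assume "y \<in> carrier W"
    then have "y \<in> W.span C" using Cc by simp
    then obtain c D where D: "finite D" "D \<subseteq> C" "c \<in> D \<rightarrow> carrier K" "y = W.lincomb c D"
      unfolding W.span_def by blast
    have eq: "f ` g ` D = D" using g D(2) by (force simp: image_iff)
    have fg: "f (g d) = d" if "d \<in> D" for d using g D(2) that by blast
    have *: "finite (g ` D)" "g ` D \<subseteq> B" "c \<circ> f \<in> g ` D \<rightarrow> carrier K" using D g fg by auto
    have "snd (comb (c \<circ> f) (g ` D)) = W.lincomb (c \<circ> f \<circ> g) D"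
      using comb2[OF *] eq by (simp add: comp_assoc)
    also have "\<dots> = W.lincomb c D"
      using D Cc fg by (intro W.lincomb_cong) auto
    finally have "(V.lincomb (c \<circ> f) (g ` D), y) = comb (c \<circ> f) (g ` D)" using D by (simp add: comb_def)
    then show "\<exists>x. (x, y) \<in> G" unfolding G_def using * by blast
  next
    fix x y assume "(x, y) \<in> G"
    then obtain a A where A: "finite A" "A \<subseteq> B" "a \<in> A \<rightarrow> carrier K" "(x, y) = comb a A"
      unfolding G_def by blast
    have x: "x = V.lincomb a A" and y: "y = (\<Oplus>\<^bsub>W\<^esub>b\<in>A. a b \<odot>\<^bsub>W\<^esub> f b)" using A(4) by (auto simp: comb_def)
    have z: "x = \<zero>\<^bsub>V\<^esub>" "y = \<zero>\<^bsub>W\<^esub>" if "\<And>b. b \<in> A \<Longrightarrow> a b = \<zero>\<^bsub>K\<^esub>"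
      using that A Bc(1) fB unfolding x y V.lincomb_def
      by (auto intro!: V.add.finprod_one_eqI W.add.finprod_one_eqI simp: Pi_iff subset_iff)
    have "a b = \<zero>\<^bsub>K\<^esub>" if "b \<in> A" "x = \<zero>\<^bsub>V\<^esub>" for b
      using V.lin_dep_crit[OF A(1,2,3) that(1)] that Bc x by auto
    moreover have "a b = \<zero>\<^bsub>K\<^esub>" if "b \<in> A" "y = \<zero>\<^bsub>W\<^esub>" for b
    proof (rule ccontr)
      assume "a b \<noteq> \<zero>\<^bsub>K\<^esub>"
      moreover have "g (f b) = b" "f ` A \<subseteq> C" using gf fB A that by auto
      moreover have "a \<circ> g \<in> f ` A \<rightarrow> carrier K" using A gf by (auto simp: Pi_iff subset_iff)
      moreover have "W.lincomb (a \<circ> g) (f ` A) = \<zero>\<^bsub>W\<^esub>"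
        using comb2[OF A(1-3)] A(4) that by (metis snd_conv)
      ultimately show False
        using W.lin_dep_crit[of "f ` A" C "a \<circ> g" "f b"] A(1) that Cc by auto
    qed
    ultimately show "x = \<zero>\<^bsub>V\<^esub> \<longleftrightarrow> y = \<zero>\<^bsub>W\<^esub>" using z by blast
  qed (rule that)
qed

lemma linear_bij_image_basis:
  assumes T: "linear_map K V W T" "bij_betw T (carrier V) (carrier W)" and B: "vectorspace.basis K V B"
  shows "vectorspace.basis K W (T ` B)"
proof -
  interpret linear_map K V W T by fact
  have Bc: "B \<subseteq> carrier V" "V.module.lin_indpt B" "V.module.span B = carrier V" using B unfolding V.basis_def by auto
  have inj: "inj_on T (carrier V)" and surj: "T ` carrier V = carrier W" using T(2) by (auto simp: bij_betw_def)
  have "W.module.lin_indpt (T ` B)"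
  proof
    assume "W.module.lin_dep (T ` B)"
    then obtain A a v where A: "finite A" "A \<subseteq> T ` B" "a \<in> A \<rightarrow> carrier K" "W.module.lincomb a A = \<zero>\<^bsub>W\<^esub>"
      "v \<in> A" "a v \<noteq> \<zero>\<^bsub>K\<^esub>" unfolding W.module.lin_dep_def by blast
    obtain D where D: "finite D" "D \<subseteq> B" "A = T ` D" using finite_subset_image[OF A(1,2)] by blast
    obtain d where d: "d \<in> D" "v = T d" using A D by blast
    have aD: "a \<circ> T \<in> D \<rightarrow> carrier K" using A D by auto
    have "T (V.module.lincomb (a \<circ> T) D) = \<zero>\<^bsub>W\<^esub>"
      using lincomb_linear_image[OF inj, of D a] A D Bc by auto
    moreover have "V.module.lincomb (a \<circ> T) D \<in> carrier V" using D Bc aD by (intro V.module.lincomb_closed) auto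
    ultimately have "V.module.lincomb (a \<circ> T) D = \<zero>\<^bsub>V\<^esub>" using inj by (metis T0_is_0 V.module.M.zero_closed inj_onD)
    then show False using V.module.lin_dep_crit[OF D(1,2) aD d(1)] A d Bc by simp
  qed
  moreover have "carrier W \<subseteq> W.module.span (T ` B)"
  proof
    fix y assume "y \<in> carrier W"
    then obtain x where x: "x \<in> carrier V" "y = T x" using surj by blast
    then have "x \<in> V.module.span B" using Bc by simp
    then obtain a A where A: "finite A" "A \<subseteq> B" "a \<in> A \<rightarrow> carrier K" "x = V.module.lincomb a A"
      unfolding V.module.span_def by blast
    let ?a = "a \<circ> inv_into B T"
    have injB: "inj_on T B" using inj Bc(1) by (rule inj_on_subset)
    have inv: "inv_into B T (T b) = b" if "b \<in> A" for b using A injB that by (auto intro: inv_into_f_f)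
    have a: "?a \<in> T ` A \<rightarrow> carrier K" using A inv by auto
    then have "W.module.lincomb ?a (T ` A) = T (V.module.lincomb (?a \<circ> T) A)"
      using A Bc by (intro lincomb_linear_image[OF inj]) auto
    also have "V.module.lincomb (?a \<circ> T) A = V.module.lincomb a A"
      using A Bc inv by (intro V.module.lincomb_cong) auto
    finally have "y = W.module.lincomb ?a (T ` A)" using x A by (simp only:)
    then show "y \<in> W.module.span (T ` B)" unfolding W.module.span_def using A a by blast
  qed
  moreover have "T ` B \<subseteq> carrier W" using Bc by auto
  ultimately show ?thesis unfolding W.basis_def using W.module.span_is_subset2 by blast
qed

text \<open>Trades equality of Kaplansky invariants for an isomorphism of kernels; both directions
  of the theorem use the invariants through this equivalence.\<close>

lemma vdim_ordIso_iff:
  assumes V: "vectorspace K V" and W: "vectorspace K W"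
  shows "vdim K V =o vdim K W \<longleftrightarrow> (\<exists>T. linear_map K V W T \<and> bij_betw T (carrier V) (carrier W))"
proof
  interpret V: vectorspace K V by fact
  interpret W: vectorspace K W by fact
  obtain B C where B: "V.basis B" and C: "W.basis C" using V.basis_exists W.basis_exists by blast
  show "\<exists>T. linear_map K V W T \<and> bij_betw T (carrier V) (carrier W)" if "vdim K V =o vdim K W"
  proof -
    have "|B| =o |C|"
      by (rule ordIso_transitive[OF ordIso_transitive[OF ordIso_symmetric[OF V.basis_vdim[OF B]] that]
        W.basis_vdim[OF C]])
    then obtain f where "bij_betw f B C" using card_of_ordIso by blast
    then show ?thesis by (blast intro: bij_betw_linear_iso_on_bases[OF V W B C])
  qed
  show "vdim K V =o vdim K W" if iso: "\<exists>T. linear_map K V W T \<and> bij_betw T (carrier V) (carrier W)"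
  proof -
    obtain T where T: "linear_map K V W T" "bij_betw T (carrier V) (carrier W)" using iso by blast
    have "bij_betw T B (T ` B)"
      using T(2) B unfolding V.basis_def bij_betw_def by (blast intro: inj_on_subset)
    then have "|B| =o |T ` B|" using card_of_ordIso by blast
    moreover have "|T ` B| =o vdim K W"
      by (rule ordIso_symmetric[OF W.basis_vdim[OF linear_bij_image_basis[OF T B]]])
    ultimately show ?thesis
      by (rule ordIso_transitive[OF V.basis_vdim[OF B] ordIso_transitive])
  qed
qed

section \<open>Quotients\<close>

context vectorspace
begin

text \<open>Gives access to the facts on cosets of additive subgroups; closure under negatives comes
  from multiplication by minus one.\<close>

lemma abelian_subgroup_submodule:
  assumes "submodule K W V"
  shows "abelian_subgroup W V"
proof (rule abelian_subgroupI3[OF additive_subgroup.intro[OF subgroup.intro]])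
  interpret W: submodule K W V by fact
  show "W \<subseteq> carrier (add_monoid V)" using W.subset by simp
  show "x \<otimes>\<^bsub>add_monoid V\<^esub> y \<in> W" if "x \<in> W" "y \<in> W" for x y using that by simp
  show "\<one>\<^bsub>add_monoid V\<^esub> \<in> W" by simp
  show "inv\<^bsub>add_monoid V\<^esub> x \<in> W" if "x \<in> W" for x
  proof -
    have "\<ominus>\<^bsub>V\<^esub> x = \<ominus>\<^bsub>K\<^esub> \<one>\<^bsub>K\<^esub> \<odot>\<^bsub>V\<^esub> x" using that W.subset smult_minus_1 by auto
    then show ?thesis using that by (simp add: a_inv_def[symmetric])
  qed
qed (rule abelian_group_axioms)

lemma submodule_minus_closed:
  assumes "submodule K W V" "x \<in> W" "y \<in> W"
  shows "x \<ominus>\<^bsub>V\<^esub> y \<in> W"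
proof -
  interpret W: abelian_subgroup W V using assms(1) by (rule abelian_subgroup_submodule)
  show ?thesis unfolding a_minus_def using assms(2,3) by (intro W.a_closed W.a_inv_closed)
qed

lemma coset_mem_iff:
  assumes "submodule K W V" "x \<in> carrier V"
  shows "y \<in> W +>\<^bsub>V\<^esub> x \<longleftrightarrow> y \<in> carrier V \<and> y \<ominus>\<^bsub>V\<^esub> x \<in> W"
proof -
  interpret W: abelian_subgroup W V using assms(1) by (rule abelian_subgroup_submodule)
  show ?thesis
    using W.a_rcos_module[OF assms(2), of y] W.a_elemrcos_carrier[OF assms(2), of y]
    unfolding a_minus_def by argo
qed

lemma coset_eq_iff:
  assumes "submodule K W V" "x \<in> carrier V" "y \<in> carrier V"
  shows "W +>\<^bsub>V\<^esub> y = W +>\<^bsub>V\<^esub> x \<longleftrightarrow> y \<ominus>\<^bsub>V\<^esub> x \<in> W"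
proof -
  interpret W: abelian_subgroup W V using assms(1) by (rule abelian_subgroup_submodule)
  show ?thesis
    using W.a_rcos_self[OF assms(3)] M.a_repr_independence[OF _ assms(2) W.a_subgroup, of y]
      coset_mem_iff[OF assms(1,2), of y] assms(3) by auto
qed

lemma coset_zero_iff:
  assumes "submodule K W V" "x \<in> carrier V"
  shows "W +>\<^bsub>V\<^esub> x = W \<longleftrightarrow> x \<in> W"
proof -
  interpret W: abelian_subgroup W V using assms(1) by (rule abelian_subgroup_submodule)
  show ?thesis
    using M.a_coset_join1[OF _ assms(2) W.a_subgroup] M.a_coset_join2[OF assms(2) W.a_subgroup] by blast
qed

text \<open>Scalar multiplication in \<open>quot_space\<close> and the map \<open>quot_map\<close>
  are unions over all representatives; this collapses such a union once its members agree.\<close>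

lemma Union_coset_eq:
  assumes "submodule K W V" "x \<in> carrier V"
    and "\<And>y. y \<in> carrier V \<Longrightarrow> y \<ominus>\<^bsub>V\<^esub> x \<in> W \<Longrightarrow> h y = Z"
  shows "(\<Union>y\<in>W +>\<^bsub>V\<^esub> x. h y) = Z"
proof -
  interpret W: abelian_subgroup W V using assms(1) by (rule abelian_subgroup_submodule)
  have "x \<in> W +>\<^bsub>V\<^esub> x" by (rule W.a_rcos_self[OF assms(2)])
  then show ?thesis using assms(3) coset_mem_iff[OF assms(1,2)] by blast
qed

text \<open>The axioms pass along a surjection that respects the operations. With coset formation as
  \<open>p\<close>, this covers the kernel inside a quotient without first treating the quotient
  itself.\<close>

lemma vectorspace_image:
  assumes "carrier Q = p ` carrier V" "\<zero>\<^bsub>Q\<^esub> = p \<zero>\<^bsub>V\<^esub>"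
    and add: "\<And>x y. x \<in> carrier V \<Longrightarrow> y \<in> carrier V \<Longrightarrow> p x \<oplus>\<^bsub>Q\<^esub> p y = p (x \<oplus>\<^bsub>V\<^esub> y)"
    and smult: "\<And>c x. c \<in> carrier K \<Longrightarrow> x \<in> carrier V \<Longrightarrow> c \<odot>\<^bsub>Q\<^esub> p x = p (c \<odot>\<^bsub>V\<^esub> x)"
  shows "vectorspace K Q"
proof (rule vs_criteria)
  show "field K" ..
  show "\<forall>v\<in>carrier Q. \<exists>neg_v\<in>carrier Q. v \<oplus>\<^bsub>Q\<^esub> neg_v = \<zero>\<^bsub>Q\<^esub>"
  proof
    fix v assume "v \<in> carrier Q"
    then obtain x where x: "x \<in> carrier V" "v = p x" using assms(1) by blast
    then have "v \<oplus>\<^bsub>Q\<^esub> p (\<ominus>\<^bsub>V\<^esub> x) = \<zero>\<^bsub>Q\<^esub>" using add[of x "\<ominus>\<^bsub>V\<^esub> x"] assms(2) by (simp add: M.r_neg)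
    then show "\<exists>neg_v\<in>carrier Q. v \<oplus>\<^bsub>Q\<^esub> neg_v = \<zero>\<^bsub>Q\<^esub>" using x assms(1) by blast
  qed
qed (use assms(1,2) in \<open>auto simp: add smult M.a_ac smult_l_distr smult_r_distr smult_assoc1\<close>)

end

section \<open>Cyclic representations and their filtrations\<close>

text \<open>Stated for every well-order, with or without a greatest element, because it is applied
  also to the well-orders over which \<open>filt_inf\<close> ranges.\<close>

lemma filt_cases:
  assumes r: "Well_order r"
  obtains (zero) "underS r a = {}" "\<And>k. filt n u r a k = carrier (space_at u k)"
  | (succ) b where "b \<in> underS r a" "a = ord_succ r b"
      "\<And>k. filt n u r a k = arrow u (cprev n k) ` filt n u r b (cprev n k)"
  | (limit) "underS r a \<noteq> {}" "\<And>k. filt n u r a k = (\<Inter>b\<in>underS r a. filt n u r b k)"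
proof (cases "underS r a = {}")
  case True
  then show thesis by (rule zero) (rule filt_zero[OF r True])
next
  case False
  show thesis
  proof (cases "\<exists>b\<in>underS r a. a = ord_succ r b")
    case True
    then obtain b where b: "b \<in> underS r a" "a = ord_succ r b" by blast
    have "filt n u r a k = arrow u (cprev n k) ` filt n u r b (cprev n k)" for k
      by (subst filt_unfold[OF r]) (rule filt_step_succ[OF r b])
    then show thesis by (rule succ[OF b])
  next
    case n: False
    have "filt n u r a k = (\<Inter>b\<in>underS r a. filt n u r b k)" for k
      by (rule filt_limit[OF r False]) (use n in blast)
    then show thesis by (rule limit[OF False])
  qed
qed

locale limit_order =
  fixes r :: "'o rel"
  assumes Well_order: "Well_order r"
    and no_greatest: "a \<in> Field r \<Longrightarrow> \<exists>b. b \<noteq> a \<and> (a, b) \<in> r"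
begin

abbreviation S where "S \<equiv> ord_succ r"

lemma wo_rel: "wo_rel r"
  using Well_order by (simp add: wo_rel_def)

lemma ord_total: "a \<in> Field r \<Longrightarrow> b \<in> Field r \<Longrightarrow> (a, b) \<in> r \<or> (b, a) \<in> r"
  using wo_rel.TOTALS[OF wo_rel] by blast

lemma ord_trans: "(a, b) \<in> r \<Longrightarrow> (b, c) \<in> r \<Longrightarrow> (a, c) \<in> r"
  using wo_rel.TRANS[OF wo_rel] by (auto dest: transD)

lemma ord_antisym: "(a, b) \<in> r \<Longrightarrow> (b, a) \<in> r \<Longrightarrow> a = b"
  using wo_rel.ANTISYM[OF wo_rel] by (auto dest: antisymD)

lemma ord_refl: "a \<in> Field r \<Longrightarrow> (a, a) \<in> r"
  using wo_rel.REFL[OF wo_rel] by (auto dest: refl_onD)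

lemma succ_greater:
  assumes "a \<in> Field r"
  shows "(a, S a) \<in> r" "S a \<noteq> a" "S a \<in> Field r"
proof -
  have "AboveS r {a} \<noteq> {}" using no_greatest[OF assms] assms by (auto simp: AboveS_def Field_def)
  then have "(a, S a) \<in> r \<and> S a \<noteq> a"
    using wo_rel.suc_greater[OF wo_rel, of "{a}" a] assms by (auto simp: ord_succ_def)
  then show "(a, S a) \<in> r" "S a \<noteq> a" "S a \<in> Field r" by (auto simp: Field_def)
qed

lemma succ_least: "(a, b) \<in> r \<Longrightarrow> a \<noteq> b \<Longrightarrow> (S a, b) \<in> r"
  unfolding ord_succ_def
  by (rule wo_rel.suc_least_AboveS[OF wo_rel]) (auto simp: AboveS_def Field_def)

lemma ord_cases:
  assumes "a \<in> Field r" "b \<in> Field r"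
  obtains "(a, b) \<in> r" | "(S b, a) \<in> r"
  using ord_total[OF assms] ord_refl assms succ_least by metis

end

locale cyclic_filtration = limit_order r for r :: "'o rel" +
  fixes K :: "('f, 'm) ring_scheme" and n :: nat and u :: "('f, 'a) cyc_rep"
  assumes n: "0 < n" and rep: "cyclic_rep K n u"
begin

abbreviation U where "U \<equiv> space_at u"
abbreviation f where "f \<equiv> arrow u"
abbreviation A where "A \<equiv> filt n u r"
abbreviation nx where "nx \<equiv> cnext n"

lemma nx_less: "nx k < n" and cprev_less: "cprev n k < n"
  using n by (simp_all add: cnext_def cprev_def)

lemma nx_cprev: "k < n \<Longrightarrow> nx (cprev n k) = k" and cprev_nx: "k < n \<Longrightarrow> cprev n (nx k) = k"
proof -
  assume k: "k < n"
  show "nx (cprev n k) = k"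
    using k n by (cases k) (auto simp: cnext_def cprev_def mod_Suc)
  show "cprev n (nx k) = k"
    using k n by (cases "Suc k = n") (auto simp: cnext_def cprev_def)
qed

lemma vs: "k < n \<Longrightarrow> vectorspace K (U k)"
  and lin: "k < n \<Longrightarrow> linear_map K (U k) (U (nx k)) (f k)"
  using rep by (auto simp: cyclic_rep_def)

lemma f_closed: "k < n \<Longrightarrow> x \<in> carrier (U k) \<Longrightarrow> f k x \<in> carrier (U (nx k))"
  and f_add: "k < n \<Longrightarrow> x \<in> carrier (U k) \<Longrightarrow> y \<in> carrier (U k) \<Longrightarrow> f k (x \<oplus>\<^bsub>U k\<^esub> y) = f k x \<oplus>\<^bsub>U (nx k)\<^esub> f k y"
  and f_smult: "k < n \<Longrightarrow> x \<in> carrier (U k) \<Longrightarrow> c \<in> carrier K \<Longrightarrow> f k (c \<odot>\<^bsub>U k\<^esub> x) = c \<odot>\<^bsub>U (nx k)\<^esub> f k x"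
  and f_zero: "k < n \<Longrightarrow> f k \<zero>\<^bsub>U k\<^esub> = \<zero>\<^bsub>U (nx k)\<^esub>"
  and f_minus: "k < n \<Longrightarrow> x \<in> carrier (U k) \<Longrightarrow> y \<in> carrier (U k) \<Longrightarrow> f k (x \<ominus>\<^bsub>U k\<^esub> y) = f k x \<ominus>\<^bsub>U (nx k)\<^esub> f k y"
proof -
  assume k: "k < n"
  interpret linear_map K "U k" "U (nx k)" "f k" by (rule lin[OF k])
  show "x \<in> carrier (U k) \<Longrightarrow> f k x \<in> carrier (U (nx k))" by simp
  show "x \<in> carrier (U k) \<Longrightarrow> y \<in> carrier (U k) \<Longrightarrow> f k (x \<oplus>\<^bsub>U k\<^esub> y) = f k x \<oplus>\<^bsub>U (nx k)\<^esub> f k y" by simp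
  show "x \<in> carrier (U k) \<Longrightarrow> c \<in> carrier K \<Longrightarrow> f k (c \<odot>\<^bsub>U k\<^esub> x) = c \<odot>\<^bsub>U (nx k)\<^esub> f k x" by simp
  show "f k \<zero>\<^bsub>U k\<^esub> = \<zero>\<^bsub>U (nx k)\<^esub>" by simp
  show "x \<in> carrier (U k) \<Longrightarrow> y \<in> carrier (U k) \<Longrightarrow> f k (x \<ominus>\<^bsub>U k\<^esub> y) = f k x \<ominus>\<^bsub>U (nx k)\<^esub> f k y" by simp
qed

end

section \<open>Levels as a decreasing family of subspaces\<close>

context cyclic_filtration
begin

lemma level_cases:
  obtains (zero) "underS r a = {}" "\<And>k. A a k = carrier (U k)"
  | (succ) b where "b \<in> underS r a" "a = S b" "\<And>k. A a k = f (cprev n k) ` A b (cprev n k)"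
  | (limit) "underS r a \<noteq> {}" "\<And>k. A a k = (\<Inter>b\<in>underS r a. A b k)"
proof (rule filt_cases[OF Well_order, of a n u])
  show thesis if "underS r a = {}" "\<And>k. A a k = carrier (U k)" by (rule zero[OF that])
  show thesis if "b \<in> underS r a" "a = S b" "\<And>k. A a k = f (cprev n k) ` A b (cprev n k)" for b
    by (rule succ[OF that])
  show thesis if "underS r a \<noteq> {}" "\<And>k. A a k = (\<Inter>b\<in>underS r a. A b k)" by (rule limit[OF that])
qed

text \<open>Outside the field \<open>underS r a\<close> is empty and the level is the whole space,
  so the induction covers the whole type and statements about all levels can quantify over
  it.\<close>

lemma filt_induct:
  assumes "\<And>a. (\<And>b. b \<in> underS r a \<Longrightarrow> P b) \<Longrightarrow> P a"
  shows "P a"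
  using assms by (rule wo_rel.well_order_induct[OF wo_rel]) (auto simp: underS_def)

lemma submodule_filt: "k < n \<Longrightarrow> submodule K (A a k) (U k)"
proof (induction a arbitrary: k rule: filt_induct)
  case (1 a)
  interpret vectorspace K "U k" by (rule vs[OF 1(2)])
  show ?case
  proof (cases a rule: level_cases)
    case zero
    then show ?thesis by (simp add: submodule_def module_axioms)
  next
    case (succ b)
    let ?j = "cprev n k"
    have j: "?j < n" "nx ?j = k" by (simp_all add: cprev_less nx_cprev 1)
    interpret W: submodule K "A b ?j" "U ?j" using 1(1)[OF succ(1) j(1)] .
    have c: "x \<in> carrier (U ?j)" if "x \<in> A b ?j" for x using that W.subset by blast
    show ?thesis unfolding succ(3)
    proof (rule submodule.intro[OF module_axioms])
      show "f ?j ` A b ?j \<subseteq> carrier (U k)" using f_closed[OF j(1)] c j(2) by auto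
      show "\<zero>\<^bsub>U k\<^esub> \<in> f ?j ` A b ?j" using imageI[OF W.zero_closed, of "f ?j"] f_zero[OF j(1)] j(2) by simp
      show "v \<oplus>\<^bsub>U k\<^esub> w \<in> f ?j ` A b ?j" if "v \<in> f ?j ` A b ?j" "w \<in> f ?j ` A b ?j" for v w
      proof -
        obtain x y where "v = f ?j x" "x \<in> A b ?j" "w = f ?j y" "y \<in> A b ?j" using \<open>v \<in> _\<close> \<open>w \<in> _\<close> by blast
        then show ?thesis using f_add[OF j(1) c c, of x y] j(2) imageI[OF W.m_closed[of x y], of "f ?j"] by simp
      qed
      show "x \<odot>\<^bsub>U k\<^esub> v \<in> f ?j ` A b ?j" if "x \<in> carrier K" "v \<in> f ?j ` A b ?j" for x v
      proof -
        obtain y where "v = f ?j y" "y \<in> A b ?j" using \<open>v \<in> _\<close> by blast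
        then show ?thesis
          using f_smult[OF j(1) c \<open>x \<in> carrier K\<close>, of y] j(2)
            imageI[OF W.smult_closed[OF \<open>x \<in> carrier K\<close>, of y], of "f ?j"] by simp
      qed
    qed
  next
    case limit
    have W: "submodule K (A b k) (U k)" if "b \<in> underS r a" for b using 1 that by blast
    show ?thesis unfolding limit(2)
    proof (rule submodule.intro[OF module_axioms])
      show "(\<Inter>b\<in>underS r a. A b k) \<subseteq> carrier (U k)" using limit(1) submodule.subset[OF W] by blast
    qed (auto intro: submodule.m_closed[OF W] submodule.zero_closed[OF W] submodule.smult_closed[OF W])
  qed
qed

lemma filt_carrier: "k < n \<Longrightarrow> x \<in> A a k \<Longrightarrow> x \<in> carrier (U k)"
  and filt_0: "k < n \<Longrightarrow> \<zero>\<^bsub>U k\<^esub> \<in> A a k"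
  and filt_add: "k < n \<Longrightarrow> x \<in> A a k \<Longrightarrow> y \<in> A a k \<Longrightarrow> x \<oplus>\<^bsub>U k\<^esub> y \<in> A a k"
  and filt_smult: "k < n \<Longrightarrow> c \<in> carrier K \<Longrightarrow> x \<in> A a k \<Longrightarrow> c \<odot>\<^bsub>U k\<^esub> x \<in> A a k"
  and filt_minus: "k < n \<Longrightarrow> x \<in> A a k \<Longrightarrow> y \<in> A a k \<Longrightarrow> x \<ominus>\<^bsub>U k\<^esub> y \<in> A a k"
  using submodule.subset[OF submodule_filt] submodule.zero_closed[OF submodule_filt]
    submodule.m_closed[OF submodule_filt] submodule.smult_closed[OF submodule_filt]
    vectorspace.submodule_minus_closed[OF vs submodule_filt] by blast+

lemma filt_Suc: "a \<in> Field r \<Longrightarrow> k < n \<Longrightarrow> A (S a) (nx k) = f k ` A a k"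
  using filt_succ[OF Well_order] succ_greater by (metis cprev_nx)

lemma filt_Suc': "a \<in> Field r \<Longrightarrow> k < n \<Longrightarrow> A (S a) k = f (cprev n k) ` A a (cprev n k)"
  using filt_Suc[OF _ cprev_less] nx_cprev by metis

lemma f_filt: "a \<in> Field r \<Longrightarrow> k < n \<Longrightarrow> x \<in> A a k \<Longrightarrow> f k x \<in> A (S a) (nx k)"
  by (simp add: filt_Suc)

text \<open>All vertices are treated at once, since a step of the filtration comes from the
  preceding vertex. At a successor the arrow is applied to the known inclusion; at a limit
  \<open>A (S a) k\<close> lies in each \<open>A (S b) k\<close> with \<open>b\<close> below
  \<open>a\<close>, hence in \<open>A b k\<close>.\<close>

lemma filt_Suc_subset: "a \<in> Field r \<Longrightarrow> k < n \<Longrightarrow> A (S a) k \<subseteq> A a k"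
proof (induction a arbitrary: k rule: filt_induct)
  case (1 a)
  have j: "cprev n k < n" by (rule cprev_less)
  have Sa: "A (S a) k = f (cprev n k) ` A a (cprev n k)" by (rule filt_Suc'[OF 1(2,3)])
  have F: "b \<in> Field r" if "b \<in> underS r a" for b using that by (auto simp: underS_def Field_def)
  show ?case
  proof (cases a rule: level_cases)
    case zero
    then show ?thesis using filt_carrier[OF 1(3)] by blast
  next
    case (succ b)
    have "A a (cprev n k) \<subseteq> A b (cprev n k)" using 1(1)[OF succ(1) F[OF succ(1)] j] succ(2) by simp
    then show ?thesis unfolding Sa succ(3)[of k] by blast
  next
    case limit
    have "A (S a) k \<subseteq> A b k" if b: "b \<in> underS r a" for b
    proof -
      have "A a (cprev n k) \<subseteq> A b (cprev n k)" unfolding limit(2) using b by blast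
      then have "A (S a) k \<subseteq> A (S b) k" unfolding Sa filt_Suc'[OF F[OF b] 1(3)] by blast
      then show ?thesis using 1(1)[OF b F[OF b] 1(3)] by blast
    qed
    then show ?thesis unfolding limit(2)[of k] by blast
  qed
qed

lemma filt_antimono: "(a, b) \<in> r \<Longrightarrow> k < n \<Longrightarrow> A b k \<subseteq> A a k"
proof (induction b rule: filt_induct)
  case (1 b)
  show ?case
  proof (cases "a = b")
    case False
    have a: "a \<in> underS r b" using 1(2) False by (simp add: underS_def)
    show ?thesis
    proof (cases b rule: level_cases)
      case (succ c)
      have c: "(c, b) \<in> r" "c \<noteq> b" "c \<in> Field r" "a \<in> Field r" using succ(1) 1(2) by (auto simp: underS_def Field_def)
      have "(a, c) \<in> r"
      proof (rule ccontr)
        assume n: "(a, c) \<notin> r"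
        then have "(c, a) \<in> r" "c \<noteq> a" using ord_total[OF c(4,3)] by auto
        then have "(b, a) \<in> r" using succ_least succ(2) by blast
        then show False using ord_antisym 1(2) False by blast
      qed
      then show ?thesis using 1(1)[OF succ(1)] 1(3) filt_Suc_subset[OF c(3)] succ(2) by blast
    qed (use a in auto)
  qed simp
qed

text \<open>The least level that does not contain \<open>x\<close> is a successor.\<close>

lemma filt_jump:
  assumes "k < n" "x \<in> carrier (U k)" "x \<notin> A b k"
  obtains a where "a \<in> Field r" "x \<in> A a k" "x \<notin> A (S a) k"
proof -
  have "\<exists>a\<in>Field r. x \<in> A a k \<and> x \<notin> A (S a) k" using assms(3)
  proof (induction b rule: filt_induct)
    case (1 b)
    show ?case
    proof (cases b rule: level_cases)
      case zero
      then show ?thesis using 1(2) assms by simp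
    next
      case (succ c)
      then show ?thesis using 1 by (cases "x \<in> A c k") (auto simp: underS_def Field_def)
    next
      case limit
      then show ?thesis using 1 by auto
    qed
  qed
  then show thesis using that by blast
qed

text \<open>The inverse image in level \<open>a\<close> of the kernel whose dimension is the
  Kaplansky invariant. It contains level \<open>a + 1\<close>, so the kernel itself is
  \<open>kap a k\<close> modulo that level.\<close>

definition kap :: "'o \<Rightarrow> nat \<Rightarrow> 'a set" where
  "kap a k = {x \<in> A a k. f k x \<in> A (S (S a)) (nx k)}"

text \<open>Describes the kernel by representatives, with \<open>p\<close> as the projection from
  \<open>kap a k\<close>, so that the extension argument can work with vectors instead of
  cosets.\<close>

lemma kaplansky_space:
  fixes a k
  defines "Q \<equiv> filt_quot n u r k a
      \<lparr>carrier := a_kernel (filt_quot n u r k a) (filt_quot n u r (nx k) (S a)) (induced_arrow n u r k a)\<rparr>"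
    and "p \<equiv> \<lambda>x. A (S a) k +>\<^bsub>U k\<^esub> x"
  assumes a: "a \<in> Field r" and k: "k < n"
  shows "vectorspace K Q" "carrier Q = p ` kap a k"
    "\<And>x y. x \<in> kap a k \<Longrightarrow> y \<in> kap a k \<Longrightarrow> p x \<oplus>\<^bsub>Q\<^esub> p y = p (x \<oplus>\<^bsub>U k\<^esub> y)"
    "\<And>c x. c \<in> carrier K \<Longrightarrow> x \<in> kap a k \<Longrightarrow> c \<odot>\<^bsub>Q\<^esub> p x = p (c \<odot>\<^bsub>U k\<^esub> x)"
    "\<And>x. x \<in> kap a k \<Longrightarrow> p x = \<zero>\<^bsub>Q\<^esub> \<longleftrightarrow> x \<in> A (S a) k"
    "submodule K (kap a k) (U k)"
proof -
  interpret vectorspace K "U k" by (rule vs[OF k])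
  interpret N: vectorspace K "U (nx k)" by (rule vs[OF nx_less])
  note W = submodule_filt[OF k, of "S a"] and W' = submodule_filt[OF nx_less, of "S (S a)"]
  interpret W: abelian_subgroup "A (S a) k" "U k" by (rule abelian_subgroup_submodule[OF W])
  have kap: "x \<in> carrier (U k)" "x \<in> A a k" "f k x \<in> A (S (S a)) (nx k)" if "x \<in> kap a k" for x
    using that filt_carrier[OF k] by (auto simp: kap_def)
  show sub: "submodule K (kap a k) (U k)"
  proof (rule submodule.intro[OF module_axioms])
    show "kap a k \<subseteq> carrier (U k)" using kap by blast
    show "\<zero>\<^bsub>U k\<^esub> \<in> kap a k" using k by (simp add: kap_def f_zero filt_0 nx_less)
    show "x \<oplus>\<^bsub>U k\<^esub> y \<in> kap a k" if "x \<in> kap a k" "y \<in> kap a k" for x y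
      using that k by (simp add: kap_def f_add filt_add nx_less filt_carrier[OF k, of _ a])
    show "c \<odot>\<^bsub>U k\<^esub> x \<in> kap a k" if "c \<in> carrier K" "x \<in> kap a k" for c x
      using that k by (simp add: kap_def f_smult filt_smult nx_less filt_carrier[OF k, of _ a])
  qed
  \<comment> \<open>The choice of representative does not matter because the arrow takes level
    \<open>a + 1\<close> to level \<open>a + 2\<close>.\<close>
  have ind: "induced_arrow n u r k a (p x) = A (S (S a)) (nx k) +>\<^bsub>U (nx k)\<^esub> f k x" if "x \<in> A a k" for x
  proof -
    have x: "x \<in> carrier (U k)" using that filt_carrier[OF k] by blast
    have "(\<Union>y\<in>p x. A (S (S a)) (nx k) +>\<^bsub>U (nx k)\<^esub> f k y) = A (S (S a)) (nx k) +>\<^bsub>U (nx k)\<^esub> f k x"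
      unfolding p_def
    proof (rule Union_coset_eq[OF W x])
      fix y assume y: "y \<in> carrier (U k)" "y \<ominus>\<^bsub>U k\<^esub> x \<in> A (S a) k"
      then have "f k y \<ominus>\<^bsub>U (nx k)\<^esub> f k x \<in> A (S (S a)) (nx k)"
        using f_filt[OF _ k y(2)] f_minus[OF k y(1) x] succ_greater(3)[OF a] by simp
      then show "A (S (S a)) (nx k) +>\<^bsub>U (nx k)\<^esub> f k y = A (S (S a)) (nx k) +>\<^bsub>U (nx k)\<^esub> f k x"
        using N.coset_eq_iff[OF W'] f_closed[OF k] x y by blast
    qed
    then show ?thesis by (simp add: induced_arrow_def quot_map_def a_r_coset_def r_coset_def)
  qed
  have fq: "carrier (filt_quot n u r k a) = p ` A a k"
    by (auto simp: filt_quot_def quot_space_def p_def A_RCOSETS_def RCOSETS_def a_r_coset_def r_coset_def)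
  show car: "carrier Q = p ` kap a k"
  proof -
    have z: "\<zero>\<^bsub>filt_quot n u r (nx k) (S a)\<^esub> = A (S (S a)) (nx k)" by (simp add: filt_quot_def quot_space_def)
    have "induced_arrow n u r k a (p x) = \<zero>\<^bsub>filt_quot n u r (nx k) (S a)\<^esub> \<longleftrightarrow> x \<in> kap a k" if "x \<in> A a k" for x
      using N.coset_zero_iff[OF W' f_closed[OF k filt_carrier[OF k that]]] ind[OF that] that z
      by (simp add: kap_def)
    then show ?thesis using kap(2) unfolding Q_def by (auto simp: a_kernel_def' fq)
  qed
  show add: "p x \<oplus>\<^bsub>Q\<^esub> p y = p (x \<oplus>\<^bsub>U k\<^esub> y)" if "x \<in> kap a k" "y \<in> kap a k" for x y
    using W.a_rcos_sum[OF kap(1)[OF that(1)] kap(1)[OF that(2)]]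
    by (simp add: Q_def filt_quot_def quot_space_def p_def set_add_def set_mult_def)
  show smult: "c \<odot>\<^bsub>Q\<^esub> p x = p (c \<odot>\<^bsub>U k\<^esub> x)" if c: "c \<in> carrier K" and "x \<in> kap a k" for c x
  proof -
    have x: "x \<in> carrier (U k)" using that kap by blast
    have "(\<Union>y\<in>p x. p (c \<odot>\<^bsub>U k\<^esub> y)) = p (c \<odot>\<^bsub>U k\<^esub> x)" unfolding p_def
    proof (rule Union_coset_eq[OF W x])
      fix y assume y: "y \<in> carrier (U k)" "y \<ominus>\<^bsub>U k\<^esub> x \<in> A (S a) k"
      have "c \<odot>\<^bsub>U k\<^esub> y \<ominus>\<^bsub>U k\<^esub> c \<odot>\<^bsub>U k\<^esub> x = c \<odot>\<^bsub>U k\<^esub> (y \<ominus>\<^bsub>U k\<^esub> x)"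
        using c x y by (simp add: a_minus_def smult_r_distr smult_r_minus)
      then show "A (S a) k +>\<^bsub>U k\<^esub> (c \<odot>\<^bsub>U k\<^esub> y) = A (S a) k +>\<^bsub>U k\<^esub> (c \<odot>\<^bsub>U k\<^esub> x)"
        using coset_eq_iff[OF W] filt_smult[OF k c y(2)] c x y by simp
    qed
    then show ?thesis
      by (simp add: Q_def filt_quot_def quot_space_def p_def a_r_coset_def r_coset_def)
  qed
  have zero: "\<zero>\<^bsub>Q\<^esub> = A (S a) k" by (simp add: Q_def filt_quot_def quot_space_def)
  show "p x = \<zero>\<^bsub>Q\<^esub> \<longleftrightarrow> x \<in> A (S a) k" if "x \<in> kap a k" for x
    unfolding zero p_def using that kap by (intro coset_zero_iff[OF W]) blast
  interpret kap: vectorspace K "U k\<lparr>carrier := kap a k\<rparr>"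
    by (rule subspace_is_vs[OF subspace.intro[OF vs[OF k] sub]])
  show "vectorspace K Q"
  proof (rule kap.vectorspace_image[of _ p])
    show "\<zero>\<^bsub>Q\<^esub> = p \<zero>\<^bsub>U k\<lparr>carrier := kap a k\<rparr>\<^esub>"
      using coset_zero_iff[OF W M.zero_closed] filt_0[OF k] unfolding zero p_def by simp
  qed (use car add smult in auto)
qed

end

context vectorspace
begin

lemma add_minus_add_left:
  "x \<in> carrier V \<Longrightarrow> y \<in> carrier V \<Longrightarrow> z \<in> carrier V \<Longrightarrow> (x \<oplus>\<^bsub>V\<^esub> y) \<ominus>\<^bsub>V\<^esub> (x \<oplus>\<^bsub>V\<^esub> z) = y \<ominus>\<^bsub>V\<^esub> z"
  by (subst M.a_comm[of x y]) (simp_all add: a_minus_def M.minus_add M.a_assoc M.r_neg2)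

lemma minus_add_cancel:
  "x \<in> carrier V \<Longrightarrow> y \<in> carrier V \<Longrightarrow> (x \<ominus>\<^bsub>V\<^esub> y) \<oplus>\<^bsub>V\<^esub> y = x"
  by (simp add: a_minus_def M.a_assoc M.l_neg)

lemma add_minus_cancel_left:
  "x \<in> carrier V \<Longrightarrow> y \<in> carrier V \<Longrightarrow> (x \<oplus>\<^bsub>V\<^esub> y) \<ominus>\<^bsub>V\<^esub> x = y"
  by (subst M.a_comm) (simp_all add: a_minus_def M.a_assoc M.r_neg)

lemma submodule_add_iff:
  assumes "submodule K W V" "x \<in> W" "y \<in> carrier V"
  shows "x \<oplus>\<^bsub>V\<^esub> y \<in> W \<longleftrightarrow> y \<in> W"
proof -
  interpret W: submodule K W V by fact
  have "x \<in> carrier V" using assms(2) W.subset by blast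
  then show ?thesis
    using submodule_minus_closed[OF assms(1) _ assms(2), of "x \<oplus>\<^bsub>V\<^esub> y"] add_minus_cancel_left[of x y]
      W.m_closed[OF assms(2), of y] assms(3) by auto
qed

lemma smult_inverse:
  assumes "c \<in> carrier K" "c \<noteq> \<zero>\<^bsub>K\<^esub>" "x \<in> carrier V"
  shows "inv\<^bsub>K\<^esub> c \<in> carrier K" "inv\<^bsub>K\<^esub> c \<odot>\<^bsub>V\<^esub> (c \<odot>\<^bsub>V\<^esub> x) = x" "c \<odot>\<^bsub>V\<^esub> (inv\<^bsub>K\<^esub> c \<odot>\<^bsub>V\<^esub> x) = x"
proof -
  have c: "c \<in> Units K" using assms field_Units by blast
  then show "inv\<^bsub>K\<^esub> c \<in> carrier K" by (rule R.Units_inv_closed)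
  then show "inv\<^bsub>K\<^esub> c \<odot>\<^bsub>V\<^esub> (c \<odot>\<^bsub>V\<^esub> x) = x" "c \<odot>\<^bsub>V\<^esub> (inv\<^bsub>K\<^esub> c \<odot>\<^bsub>V\<^esub> x) = x"
    using assms c by (simp_all add: smult_assoc1[symmetric])
qed

lemma submodule_smult_iff:
  assumes "submodule K W V" "c \<in> carrier K" "c \<noteq> \<zero>\<^bsub>K\<^esub>" "x \<in> carrier V"
  shows "c \<odot>\<^bsub>V\<^esub> x \<in> W \<longleftrightarrow> x \<in> W"
proof -
  interpret W: submodule K W V by fact
  show ?thesis
    using W.smult_closed[OF assms(2), of x] W.smult_closed[OF smult_inverse(1)[OF assms(2-4)], of "c \<odot>\<^bsub>V\<^esub> x"]
      smult_inverse(2)[OF assms(2-4)] by auto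
qed

end

context limit_order
begin

lemma succ_mono: "(a, b) \<in> r \<Longrightarrow> (S a, S b) \<in> r"
proof (cases "a = b")
  case True
  assume "(a, b) \<in> r"
  then have "a \<in> Field r" by (simp add: Field_def) blast
  then show ?thesis using ord_refl[OF succ_greater(3)] True by simp
next
  case False
  assume ab: "(a, b) \<in> r"
  then have "b \<in> Field r" by (simp add: Field_def) blast
  then show ?thesis using ord_trans[OF succ_least[OF ab False] succ_greater(1)] by simp
qed

lemma finite_greatest:
  assumes "finite J" "J \<noteq> {}" "J \<subseteq> Field r"
  shows "\<exists>m\<in>J. \<forall>a\<in>J. (a, m) \<in> r"
  using assms
proof (induction J rule: finite_ne_induct)
  case (singleton x)
  then show ?case using ord_refl by simp
next
  case (insert x J)
  then obtain m where m: "m \<in> J" "\<forall>a\<in>J. (a, m) \<in> r" by auto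
  have F: "x \<in> Field r" "m \<in> Field r" using insert.prems m(1) by auto
  show ?case
  proof (cases "(x, m) \<in> r")
    case True
    then show ?thesis using m by auto
  next
    case False
    then have "(m, x) \<in> r" using ord_total[OF F] by simp
    then have "\<forall>a\<in>insert x J. (a, x) \<in> r" using m(2) ord_trans[of _ m x] ord_refl[OF F(1)] by auto
    then show ?thesis by blast
  qed
qed

end

section \<open>Heights in subspaces and cosets\<close>

context cyclic_filtration
begin

lemma filt_add_iff: "k < n \<Longrightarrow> x \<in> A a k \<Longrightarrow> y \<in> carrier (U k) \<Longrightarrow> x \<oplus>\<^bsub>U k\<^esub> y \<in> A a k \<longleftrightarrow> y \<in> A a k"
  by (rule vectorspace.submodule_add_iff[OF vs submodule_filt])

lemma filt_smult_iff: "k < n \<Longrightarrow> c \<in> carrier K \<Longrightarrow> c \<noteq> \<zero>\<^bsub>K\<^esub> \<Longrightarrow> x \<in> carrier (U k) \<Longrightarrow>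
    c \<odot>\<^bsub>U k\<^esub> x \<in> A a k \<longleftrightarrow> x \<in> A a k"
  by (rule vectorspace.submodule_smult_iff[OF vs submodule_filt])

lemma kap_add_iff: "a \<in> Field r \<Longrightarrow> k < n \<Longrightarrow> x \<in> kap a k \<Longrightarrow> y \<in> carrier (U k) \<Longrightarrow> x \<oplus>\<^bsub>U k\<^esub> y \<in> kap a k \<longleftrightarrow> y \<in> kap a k"
  by (rule vectorspace.submodule_add_iff[OF vs kaplansky_space(6)])

lemma kap_smult_iff: "a \<in> Field r \<Longrightarrow> k < n \<Longrightarrow> c \<in> carrier K \<Longrightarrow> c \<noteq> \<zero>\<^bsub>K\<^esub> \<Longrightarrow> x \<in> carrier (U k) \<Longrightarrow>
    c \<odot>\<^bsub>U k\<^esub> x \<in> kap a k \<longleftrightarrow> x \<in> kap a k"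
  by (rule vectorspace.submodule_smult_iff[OF vs kaplansky_space(6)])

lemma kap_carrier: "k < n \<Longrightarrow> x \<in> kap a k \<Longrightarrow> x \<in> carrier (U k)"
  unfolding kap_def using filt_carrier by blast

lemma filt_Suc_kap:
  assumes "a \<in> Field r" "k < n" "x \<in> A (S a) k"
  shows "x \<in> kap a k"
  using f_filt[OF succ_greater(3)] filt_Suc_subset assms unfolding kap_def by blast

text \<open>The heights that occur in \<open>X\<close>. The zero vector has none, nor has any other
  vector that lies in every level.\<close>

definition jumps :: "nat \<Rightarrow> 'a set \<Rightarrow> 'o set" where
  "jumps k X = {a \<in> Field r. \<exists>x\<in>X. x \<in> A a k \<and> x \<notin> A (S a) k}"

text \<open>If two elements of a coset of \<open>D\<close> have distinct heights, then the smaller height is that of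
  their difference.\<close>

lemma finite_jumps_coset:
  assumes k: "k < n" and D: "D \<subseteq> carrier (U k)" "\<And>s t. s \<in> D \<Longrightarrow> t \<in> D \<Longrightarrow> s \<ominus>\<^bsub>U k\<^esub> t \<in> D"
    and x: "x \<in> carrier (U k)" and finD: "finite (jumps k D)"
  shows "finite (jumps k ((\<lambda>s. x \<oplus>\<^bsub>U k\<^esub> s) ` D))" (is "finite ?J")
proof -
  interpret vectorspace K "U k" by (rule vs[OF k])
  have *: "a \<in> jumps k D" if a: "a \<in> ?J" and b: "b \<in> ?J" and ab: "(a, b) \<in> r" "a \<noteq> b" for a b
  proof -
    obtain s where s: "s \<in> D" "x \<oplus>\<^bsub>U k\<^esub> s \<in> A a k" "x \<oplus>\<^bsub>U k\<^esub> s \<notin> A (S a) k" and aF: "a \<in> Field r"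
      using a unfolding jumps_def by blast
    obtain t where t: "t \<in> D" "x \<oplus>\<^bsub>U k\<^esub> t \<in> A b k" using b unfolding jumps_def by blast
    have t': "x \<oplus>\<^bsub>U k\<^esub> t \<in> A (S a) k" using filt_antimono[OF succ_least[OF ab] k] t(2) by blast
    then have t'': "x \<oplus>\<^bsub>U k\<^esub> t \<in> A a k" using filt_Suc_subset[OF aF k] by blast
    have c: "s \<in> carrier (U k)" "t \<in> carrier (U k)" using s t D by auto
    have eq: "(x \<oplus>\<^bsub>U k\<^esub> s) \<ominus>\<^bsub>U k\<^esub> (x \<oplus>\<^bsub>U k\<^esub> t) = s \<ominus>\<^bsub>U k\<^esub> t" using x c by (rule add_minus_add_left)
    have "s \<ominus>\<^bsub>U k\<^esub> t \<in> A a k" using filt_minus[OF k s(2) t''] eq by simp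
    moreover have "s \<ominus>\<^bsub>U k\<^esub> t \<notin> A (S a) k"
    proof
      assume "s \<ominus>\<^bsub>U k\<^esub> t \<in> A (S a) k"
      then have "((x \<oplus>\<^bsub>U k\<^esub> s) \<ominus>\<^bsub>U k\<^esub> (x \<oplus>\<^bsub>U k\<^esub> t)) \<oplus>\<^bsub>U k\<^esub> (x \<oplus>\<^bsub>U k\<^esub> t) \<in> A (S a) k"
        unfolding eq using t' by (rule filt_add[OF k])
      then show False using s(3) x c by (simp add: minus_add_cancel)
    qed
    ultimately show ?thesis using D(2)[OF s(1) t(1)] aF unfolding jumps_def by blast
  qed
  have F: "?J \<subseteq> Field r" unfolding jumps_def by blast
  show ?thesis
  \<comment> \<open>Only the largest height of the coset can be missing from
    \<open>jumps k D\<close>, since every smaller one is the height of a difference. So at most one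
    height is new.\<close>
  proof (cases "?J \<subseteq> jumps k D")
    case True
    then show ?thesis using finD finite_subset by blast
  next
    case False
    then obtain c where c: "c \<in> ?J" "c \<notin> jumps k D" by blast
    have "?J \<subseteq> insert c (jumps k D)"
    proof
      fix a assume a: "a \<in> ?J"
      have "(a, c) \<in> r \<or> (c, a) \<in> r" using ord_total F a c(1) by blast
      then show "a \<in> insert c (jumps k D)" using *[OF a c(1)] *[OF c(1) a] c(2) by blast
    qed
    then show ?thesis using finD finite_subset by blast
  qed
qed

text \<open>Finitely many heights have a largest one; in an arbitrary coset they could grow without
  a maximum. The hypothesis \<open>out\<close> gives every element of the coset a height.\<close>

lemma coset_proper_element:
  assumes k: "k < n" and D: "D \<subseteq> carrier (U k)" "\<And>s t. s \<in> D \<Longrightarrow> t \<in> D \<Longrightarrow> s \<ominus>\<^bsub>U k\<^esub> t \<in> D" "D \<noteq> {}"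
    and x: "x \<in> carrier (U k)" and finD: "finite (jumps k D)"
    and out: "\<And>s. s \<in> D \<Longrightarrow> \<exists>a. x \<oplus>\<^bsub>U k\<^esub> s \<notin> A a k"
  obtains s a where "s \<in> D" "a \<in> Field r" "x \<oplus>\<^bsub>U k\<^esub> s \<in> A a k" "\<And>t. t \<in> D \<Longrightarrow> x \<oplus>\<^bsub>U k\<^esub> t \<notin> A (S a) k"
proof -
  interpret vectorspace K "U k" by (rule vs[OF k])
  let ?J = "jumps k ((\<lambda>s. x \<oplus>\<^bsub>U k\<^esub> s) ` D)"
  have jump: "\<exists>a\<in>?J. x \<oplus>\<^bsub>U k\<^esub> s \<in> A a k \<and> x \<oplus>\<^bsub>U k\<^esub> s \<notin> A (S a) k" if s: "s \<in> D" for s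
  proof -
    obtain b where b: "x \<oplus>\<^bsub>U k\<^esub> s \<notin> A b k" using out[OF s] by blast
    have "x \<oplus>\<^bsub>U k\<^esub> s \<in> carrier (U k)" using x s D(1) by auto
    then obtain a where "a \<in> Field r" "x \<oplus>\<^bsub>U k\<^esub> s \<in> A a k" "x \<oplus>\<^bsub>U k\<^esub> s \<notin> A (S a) k"
      using filt_jump[OF k _ b] by metis
    then show ?thesis using s unfolding jumps_def by blast
  qed
  have "finite ?J" by (rule finite_jumps_coset[OF k D(1,2) x finD])
  moreover have "?J \<noteq> {}" using jump D(3) by blast
  moreover have F: "?J \<subseteq> Field r" unfolding jumps_def by blast
  ultimately obtain m where m: "m \<in> ?J" "\<forall>a\<in>?J. (a, m) \<in> r" using finite_greatest by meson
  obtain s where s: "s \<in> D" "x \<oplus>\<^bsub>U k\<^esub> s \<in> A m k" using m(1) unfolding jumps_def by blast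
  have "x \<oplus>\<^bsub>U k\<^esub> t \<notin> A (S m) k" if t: "t \<in> D" for t
  proof
    assume *: "x \<oplus>\<^bsub>U k\<^esub> t \<in> A (S m) k"
    obtain a where a: "a \<in> ?J" "x \<oplus>\<^bsub>U k\<^esub> t \<notin> A (S a) k" using jump[OF t] by blast
    have "(S a, S m) \<in> r" using m(2) a(1) succ_mono by blast
    then show False using filt_antimono[OF _ k] * a(2) by blast
  qed
  then show thesis using that[OF s(1) _ s(2)] m(1) F by blast
qed

end

section \<open>Extension of height-preserving partial isomorphisms\<close>

text \<open>The relation \<open>\<Theta> a k\<close> is the pull-back of an isomorphism between the kernels whose dimensions
  are the Kaplansky invariants.\<close>

locale filtration_pair =
  u: cyclic_filtration r K n u + v: cyclic_filtration r K n v
  for r :: "'o rel" and K :: "('f, 'm) ring_scheme" and n :: nat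
    and u :: "('f, 'a) cyc_rep" and v :: "('f, 'b) cyc_rep" +
  fixes \<Theta> :: "'o \<Rightarrow> nat \<Rightarrow> ('a \<times> 'b) set"
  assumes theta_linear: "a \<in> Field r \<Longrightarrow> k < n \<Longrightarrow> linear_relation K (u.U k) (v.U k) (\<Theta> a k)"
    and theta_kap: "a \<in> Field r \<Longrightarrow> k < n \<Longrightarrow> (x, y) \<in> \<Theta> a k \<Longrightarrow> x \<in> u.kap a k \<and> y \<in> v.kap a k"
    and theta_dom: "a \<in> Field r \<Longrightarrow> k < n \<Longrightarrow> x \<in> u.kap a k \<Longrightarrow> \<exists>y. (x, y) \<in> \<Theta> a k"
    and theta_ran: "a \<in> Field r \<Longrightarrow> k < n \<Longrightarrow> y \<in> v.kap a k \<Longrightarrow> \<exists>x. (x, y) \<in> \<Theta> a k"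
    and theta_level: "a \<in> Field r \<Longrightarrow> k < n \<Longrightarrow> (x, y) \<in> \<Theta> a k \<Longrightarrow> x \<in> u.A (ord_succ r a) k \<longleftrightarrow> y \<in> v.A (ord_succ r a) k"
    and theta_deep: "a \<in> Field r \<Longrightarrow> k < n \<Longrightarrow> x \<in> u.A (ord_succ r a) k \<Longrightarrow> y \<in> v.A (ord_succ r a) k \<Longrightarrow> (x, y) \<in> \<Theta> a k"
    and u_separated: "k < n \<Longrightarrow> x \<in> carrier (u.U k) \<Longrightarrow> (\<And>a. x \<in> u.A a k) \<Longrightarrow> x = \<zero>\<^bsub>u.U k\<^esub>"
    and v_separated: "k < n \<Longrightarrow> y \<in> carrier (v.U k) \<Longrightarrow> (\<And>a. y \<in> v.A a k) \<Longrightarrow> y = \<zero>\<^bsub>v.U k\<^esub>"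
begin

text \<open>Because of this symmetry, only extensions of the domain have to be proved; those of the
  range follow by exchanging \<open>u\<close> and \<open>v\<close>.\<close>

lemma filtration_pair_converse: "filtration_pair r K n v u (\<lambda>a k. (\<Theta> a k)\<inverse>)"
proof (intro filtration_pair.intro filtration_pair_axioms.intro)
  show "linear_relation K (v.U k) (u.U k) ((\<Theta> a k)\<inverse>)" if "a \<in> Field r" "k < n" for a k
    using linear_relation_converse theta_linear[OF that] .
  show "x = \<zero>\<^bsub>u.U k\<^esub>" if "k < n" "x \<in> carrier (u.U k)" "\<And>a. x \<in> u.A a k" for k x
    using u_separated[OF that] .
  show "y = \<zero>\<^bsub>v.U k\<^esub>" if "k < n" "y \<in> carrier (v.U k)" "\<And>a. y \<in> v.A a k" for k y
    using v_separated[OF that] .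
qed (use theta_kap theta_dom theta_ran theta_level theta_deep u.cyclic_filtration_axioms v.cyclic_filtration_axioms in auto)

text \<open>Single-valuedness, the corresponding condition on \<open>v.kap a k\<close>, and
  finiteness of the heights in the range are consequences: the first follows from equal levels by
  separatedness, the others from equal levels at \<open>k\<close> and at the next vertex.\<close>

definition partial_iso :: "(nat \<Rightarrow> ('a \<times> 'b) set) \<Rightarrow> bool" where
  "partial_iso G \<longleftrightarrow> (\<forall>k<n.
     linear_relation K (u.U k) (v.U k) (G k) \<and>
     (\<forall>x y. (x, y) \<in> G k \<longrightarrow> (u.f k x, v.f k y) \<in> G (u.nx k)) \<and>
     (\<forall>a x y. (x, y) \<in> G k \<longrightarrow> a \<in> Field r \<longrightarrow> x \<in> u.A a k \<longleftrightarrow> y \<in> v.A a k) \<and>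
     (\<forall>a x y. (x, y) \<in> G k \<longrightarrow> a \<in> Field r \<longrightarrow> x \<in> u.kap a k \<longrightarrow> (x, y) \<in> \<Theta> a k) \<and>
     finite (u.jumps k (Domain (G k))))"

lemma partial_isoD:
  assumes "partial_iso G" "k < n"
  shows "linear_relation K (u.U k) (v.U k) (G k)"
    "(x, y) \<in> G k \<Longrightarrow> (u.f k x, v.f k y) \<in> G (u.nx k)"
    "(x, y) \<in> G k \<Longrightarrow> a \<in> Field r \<Longrightarrow> x \<in> u.A a k \<longleftrightarrow> y \<in> v.A a k"
    "(x, y) \<in> G k \<Longrightarrow> a \<in> Field r \<Longrightarrow> x \<in> u.kap a k \<Longrightarrow> (x, y) \<in> \<Theta> a k"
    "finite (u.jumps k (Domain (G k)))"
  using assms unfolding partial_iso_def by blast+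

text \<open>Up to a nonzero scalar, each new pair is \<open>(x + s, y + t)\<close> with
  \<open>(s, t)\<close> in \<open>G k\<close>. For levels up to \<open>a\<close>, membership of such
  a sum depends on the old summand alone, and properness keeps both sums out of all higher levels.
  So heights agree, and compatibility with \<open>\<Theta>\<close> is in question at
  \<open>a\<close> only.\<close>

lemma extend_partial_iso:
  assumes G: "partial_iso G" and k: "k < n" and a: "a \<in> Field r"
    and x: "x \<in> u.A a k" and y: "y \<in> v.A a k" and xy: "(u.f k x, v.f k y) \<in> G (u.nx k)"
    and x_proper: "\<And>s t. (s, t) \<in> G k \<Longrightarrow> x \<oplus>\<^bsub>u.U k\<^esub> s \<notin> u.A (u.S a) k"
    and y_proper: "\<And>s t. (s, t) \<in> G k \<Longrightarrow> y \<oplus>\<^bsub>v.U k\<^esub> t \<notin> v.A (u.S a) k"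
    and compat: "\<And>s t. (s, t) \<in> G k \<Longrightarrow> x \<oplus>\<^bsub>u.U k\<^esub> s \<in> u.kap a k \<Longrightarrow>
      (x \<oplus>\<^bsub>u.U k\<^esub> s, y \<oplus>\<^bsub>v.U k\<^esub> t) \<in> \<Theta> a k"
  obtains G' where "partial_iso G'" "\<And>j. G j \<subseteq> G' j" "(x, y) \<in> G' k"
proof -
  interpret U: vectorspace K "u.U k" by (rule u.vs[OF k])
  interpret V: vectorspace K "v.U k" by (rule v.vs[OF k])
  note Gk = partial_isoD[OF G k]
  note lin = Gk(1)
  have xc: "x \<in> carrier (u.U k)" by (rule u.filt_carrier[OF k x])
  have yc: "y \<in> carrier (v.U k)" by (rule v.filt_carrier[OF k y])
  have stc: "s \<in> carrier (u.U k)" "t \<in> carrier (v.U k)" if "(s, t) \<in> G k" for s t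
    using linear_relation_carrier[OF lin that] .
  define H where "H = {(s \<oplus>\<^bsub>u.U k\<^esub> c \<odot>\<^bsub>u.U k\<^esub> x, t \<oplus>\<^bsub>v.U k\<^esub> c \<odot>\<^bsub>v.U k\<^esub> y) | s t c. (s, t) \<in> G k \<and> c \<in> carrier K}"
  \<comment> \<open>Only vertex \<open>k\<close> grows, since the arrow sends the new pairs into
    \<open>G\<close> at the next vertex. If \<open>n = 1\<close>, that vertex is \<open>k\<close>
    again, and the old \<open>G k\<close> is still contained in \<open>H\<close>.\<close>
  define G' where "G' = G(k := H)"
  have HI: "(s \<oplus>\<^bsub>u.U k\<^esub> c \<odot>\<^bsub>u.U k\<^esub> x, t \<oplus>\<^bsub>v.U k\<^esub> c \<odot>\<^bsub>v.U k\<^esub> y) \<in> H" if "(s, t) \<in> G k" "c \<in> carrier K" for s t c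
    unfolding H_def using that by blast
  have GH: "G k \<subseteq> H"
  proof
    fix p assume p: "p \<in> G k"
    obtain s t where st: "p = (s, t)" by fastforce
    show "p \<in> H" using HI[of s t "\<zero>\<^bsub>K\<^esub>"] p stc[of s t] xc yc by (simp add: st)
  qed
  have xyH: "(x, y) \<in> H"
    using HI[OF linear_relation_zero[OF lin], of "\<one>\<^bsub>K\<^esub>"] xc yc by simp
  have G'sub: "G j \<subseteq> G' j" for j using GH by (simp add: G'_def)
  \<comment> \<open>Dividing by the coefficient of \<open>x\<close> reduces the questions about
    levels to sums in which \<open>x\<close> has coefficient one.\<close>
  have H_cases: "(p, q) \<in> G k \<or> (\<exists>c s t. c \<in> carrier K \<and> c \<noteq> \<zero>\<^bsub>K\<^esub> \<and> (s, t) \<in> G k \<and>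
      p = c \<odot>\<^bsub>u.U k\<^esub> (x \<oplus>\<^bsub>u.U k\<^esub> s) \<and> q = c \<odot>\<^bsub>v.U k\<^esub> (y \<oplus>\<^bsub>v.U k\<^esub> t))" if pq: "(p, q) \<in> H" for p q
  proof -
    obtain s t c where c: "(s, t) \<in> G k" "c \<in> carrier K"
      and p: "p = s \<oplus>\<^bsub>u.U k\<^esub> c \<odot>\<^bsub>u.U k\<^esub> x" and q: "q = t \<oplus>\<^bsub>v.U k\<^esub> c \<odot>\<^bsub>v.U k\<^esub> y"
      using pq unfolding H_def by blast
    note c' = stc[OF c(1)]
    show ?thesis
    proof (cases "c = \<zero>\<^bsub>K\<^esub>")
      case True
      then show ?thesis using c c' xc yc p q by simp
    next
      case False
      let ?s = "inv\<^bsub>K\<^esub> c \<odot>\<^bsub>u.U k\<^esub> s" and ?t = "inv\<^bsub>K\<^esub> c \<odot>\<^bsub>v.U k\<^esub> t"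
      note iu = U.smult_inverse[OF c(2) False c'(1)] and iv = V.smult_inverse[OF c(2) False c'(2)]
      have st: "(?s, ?t) \<in> G k" by (rule linear_relation_smult[OF lin iu(1) c(1)])
      have "p = c \<odot>\<^bsub>u.U k\<^esub> (x \<oplus>\<^bsub>u.U k\<^esub> ?s)"
        using xc c'(1) c(2) iu by (simp add: p U.smult_r_distr U.M.a_comm)
      moreover have "q = c \<odot>\<^bsub>v.U k\<^esub> (y \<oplus>\<^bsub>v.U k\<^esub> ?t)"
        using yc c'(2) c(2) iv by (simp add: q V.smult_r_distr V.M.a_comm)
      ultimately show ?thesis using c(2) False st by blast
    qed
  qed
  have linH: "linear_relation K (u.U k) (v.U k) H"
    unfolding linear_relation_def
  proof (intro conjI allI impI)
    show "H \<subseteq> carrier (u.U k) \<times> carrier (v.U k)" using stc xc yc by (auto simp: H_def)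
    show "(\<zero>\<^bsub>u.U k\<^esub>, \<zero>\<^bsub>v.U k\<^esub>) \<in> H" using GH linear_relation_zero[OF lin] by blast
  next
    fix p q p' q' assume "(p, q) \<in> H" "(p', q') \<in> H"
    then obtain s t c s' t' c' where c: "(s, t) \<in> G k" "c \<in> carrier K" "(s', t') \<in> G k" "c' \<in> carrier K"
      and p: "p = s \<oplus>\<^bsub>u.U k\<^esub> c \<odot>\<^bsub>u.U k\<^esub> x" "q = t \<oplus>\<^bsub>v.U k\<^esub> c \<odot>\<^bsub>v.U k\<^esub> y"
        "p' = s' \<oplus>\<^bsub>u.U k\<^esub> c' \<odot>\<^bsub>u.U k\<^esub> x" "q' = t' \<oplus>\<^bsub>v.U k\<^esub> c' \<odot>\<^bsub>v.U k\<^esub> y"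
      unfolding H_def by blast
    have "p \<oplus>\<^bsub>u.U k\<^esub> p' = (s \<oplus>\<^bsub>u.U k\<^esub> s') \<oplus>\<^bsub>u.U k\<^esub> (c \<oplus>\<^bsub>K\<^esub> c') \<odot>\<^bsub>u.U k\<^esub> x"
      using stc[OF c(1)] stc[OF c(3)] c xc by (simp add: p U.smult_l_distr U.M.a_ac)
    moreover have "q \<oplus>\<^bsub>v.U k\<^esub> q' = (t \<oplus>\<^bsub>v.U k\<^esub> t') \<oplus>\<^bsub>v.U k\<^esub> (c \<oplus>\<^bsub>K\<^esub> c') \<odot>\<^bsub>v.U k\<^esub> y"
      using stc[OF c(1)] stc[OF c(3)] c yc by (simp add: p V.smult_l_distr V.M.a_ac)
    ultimately show "(p \<oplus>\<^bsub>u.U k\<^esub> p', q \<oplus>\<^bsub>v.U k\<^esub> q') \<in> H"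
      using HI[OF linear_relation_add[OF lin c(1,3)] U.R.a_closed[OF c(2,4)]] by simp
  next
    fix d p q assume d: "d \<in> carrier K" and "(p, q) \<in> H"
    then obtain s t c where c: "(s, t) \<in> G k" "c \<in> carrier K"
      and p: "p = s \<oplus>\<^bsub>u.U k\<^esub> c \<odot>\<^bsub>u.U k\<^esub> x" "q = t \<oplus>\<^bsub>v.U k\<^esub> c \<odot>\<^bsub>v.U k\<^esub> y"
      unfolding H_def by blast
    have "d \<odot>\<^bsub>u.U k\<^esub> p = d \<odot>\<^bsub>u.U k\<^esub> s \<oplus>\<^bsub>u.U k\<^esub> (d \<otimes>\<^bsub>K\<^esub> c) \<odot>\<^bsub>u.U k\<^esub> x"
      using stc[OF c(1)] c d xc by (simp add: p U.smult_r_distr U.smult_assoc1)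
    moreover have "d \<odot>\<^bsub>v.U k\<^esub> q = d \<odot>\<^bsub>v.U k\<^esub> t \<oplus>\<^bsub>v.U k\<^esub> (d \<otimes>\<^bsub>K\<^esub> c) \<odot>\<^bsub>v.U k\<^esub> y"
      using stc[OF c(1)] c d yc by (simp add: p V.smult_r_distr V.smult_assoc1)
    ultimately show "(d \<odot>\<^bsub>u.U k\<^esub> p, d \<odot>\<^bsub>v.U k\<^esub> q) \<in> H"
      using HI[OF linear_relation_smult[OF lin d c(1)] U.R.m_closed[OF d c(2)]] by simp
  qed
  have arrowH: "(u.f k p, v.f k q) \<in> G' (u.nx k)" if pq: "(p, q) \<in> H" for p q
  proof -
    obtain s t c where c: "(s, t) \<in> G k" "c \<in> carrier K"
      and p: "p = s \<oplus>\<^bsub>u.U k\<^esub> c \<odot>\<^bsub>u.U k\<^esub> x" "q = t \<oplus>\<^bsub>v.U k\<^esub> c \<odot>\<^bsub>v.U k\<^esub> y"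
      using pq unfolding H_def by blast
    note linN = partial_isoD(1)[OF G u.nx_less[of k]]
    have "(u.f k s \<oplus>\<^bsub>u.U (u.nx k)\<^esub> c \<odot>\<^bsub>u.U (u.nx k)\<^esub> u.f k x, v.f k t \<oplus>\<^bsub>v.U (u.nx k)\<^esub> c \<odot>\<^bsub>v.U (u.nx k)\<^esub> v.f k y)
        \<in> G (u.nx k)"
      by (rule linear_relation_add[OF linN Gk(2)[OF c(1)] linear_relation_smult[OF linN c(2) xy]])
    moreover have "u.f k p = u.f k s \<oplus>\<^bsub>u.U (u.nx k)\<^esub> c \<odot>\<^bsub>u.U (u.nx k)\<^esub> u.f k x"
      using stc[OF c(1)] c xc by (simp add: p u.f_add[OF k] u.f_smult[OF k])
    moreover have "v.f k q = v.f k t \<oplus>\<^bsub>v.U (u.nx k)\<^esub> c \<odot>\<^bsub>v.U (u.nx k)\<^esub> v.f k y"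
      using stc[OF c(1)] c yc by (simp add: p v.f_add[OF k] v.f_smult[OF k])
    ultimately show ?thesis using G'sub by auto
  qed
  have below: "(b, a) \<in> r" if "b \<in> Field r" "w \<in> u.A b k" "w \<notin> u.A (u.S a) k" for b w
    using u.ord_cases[OF that(1) a] u.filt_antimono[OF _ k, of "u.S a" b] that(2,3) by blast
  have belowv: "(b, a) \<in> r" if "b \<in> Field r" "w \<in> v.A b k" "w \<notin> v.A (u.S a) k" for b w
    using u.ord_cases[OF that(1) a] v.filt_antimono[OF _ k, of "u.S a" b] that(2,3) by blast
  have level1: "x \<oplus>\<^bsub>u.U k\<^esub> s \<in> u.A b k \<longleftrightarrow> y \<oplus>\<^bsub>v.U k\<^esub> t \<in> v.A b k" if st: "(s, t) \<in> G k" and b: "b \<in> Field r" for s t b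
  proof (cases "(b, a) \<in> r")
    case True
    have "x \<in> u.A b k" "y \<in> v.A b k" using u.filt_antimono[OF True k] v.filt_antimono[OF True k] x y by blast+
    then show ?thesis
      using u.filt_add_iff[OF k _ stc(1)[OF st]] v.filt_add_iff[OF k _ stc(2)[OF st]] Gk(3)[OF st b] by simp
  next
    case False
    then show ?thesis using below[OF b _ x_proper[OF st]] belowv[OF b _ y_proper[OF st]] by blast
  qed
  have levelH: "p \<in> u.A b k \<longleftrightarrow> q \<in> v.A b k" if pq: "(p, q) \<in> H" and b: "b \<in> Field r" for p q b
    using H_cases[OF pq]
  proof (elim disjE exE conjE)
    assume "(p, q) \<in> G k"
    then show ?thesis using Gk(3) b by blast
  next
    fix c s t assume c: "c \<in> carrier K" "c \<noteq> \<zero>\<^bsub>K\<^esub>" and st: "(s, t) \<in> G k"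
      and p: "p = c \<odot>\<^bsub>u.U k\<^esub> (x \<oplus>\<^bsub>u.U k\<^esub> s)" "q = c \<odot>\<^bsub>v.U k\<^esub> (y \<oplus>\<^bsub>v.U k\<^esub> t)"
    show ?thesis using level1[OF st b] u.filt_smult_iff[OF k c] v.filt_smult_iff[OF k c] stc[OF st] xc yc
      by (simp add: p)
  qed
  have theta1: "(x \<oplus>\<^bsub>u.U k\<^esub> s, y \<oplus>\<^bsub>v.U k\<^esub> t) \<in> \<Theta> b k"
    if st: "(s, t) \<in> G k" and b: "b \<in> Field r" and kap: "x \<oplus>\<^bsub>u.U k\<^esub> s \<in> u.kap b k" for s t b
  proof (cases "b = a")
    case True
    then show ?thesis using compat[OF st] kap by simp
  next
    case False
    have "x \<oplus>\<^bsub>u.U k\<^esub> s \<in> u.A b k" using kap by (simp add: u.kap_def)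
    then have "(b, a) \<in> r" by (rule below[OF b _ x_proper[OF st]])
    then have Sb: "(u.S b, a) \<in> r" using False by (rule u.succ_least)
    \<comment> \<open>Strictly below \<open>a\<close>, both \<open>x\<close> and \<open>y\<close>
      lie in level \<open>b + 1\<close>, where classes vanish; so the claim is inherited from
      \<open>(s, t)\<close>.\<close>
    have xb: "x \<in> u.A (u.S b) k" and yb: "y \<in> v.A (u.S b) k"
      using u.filt_antimono[OF Sb k] v.filt_antimono[OF Sb k] x y by blast+
    have "s \<in> u.kap b k" using u.kap_add_iff[OF b k u.filt_Suc_kap[OF b k xb] stc(1)[OF st]] kap by simp
    then have "(s, t) \<in> \<Theta> b k" by (rule Gk(4)[OF st b])
    then show ?thesis by (rule linear_relation_add[OF theta_linear[OF b k] theta_deep[OF b k xb yb]])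
  qed
  have thetaH: "(p, q) \<in> \<Theta> b k" if pq: "(p, q) \<in> H" and b: "b \<in> Field r" and kap: "p \<in> u.kap b k" for p q b
    using H_cases[OF pq]
  proof (elim disjE exE conjE)
    assume "(p, q) \<in> G k"
    then show ?thesis using Gk(4) b kap by blast
  next
    fix c s t assume c: "c \<in> carrier K" "c \<noteq> \<zero>\<^bsub>K\<^esub>" and st: "(s, t) \<in> G k"
      and p: "p = c \<odot>\<^bsub>u.U k\<^esub> (x \<oplus>\<^bsub>u.U k\<^esub> s)" "q = c \<odot>\<^bsub>v.U k\<^esub> (y \<oplus>\<^bsub>v.U k\<^esub> t)"
    have "x \<oplus>\<^bsub>u.U k\<^esub> s \<in> u.kap b k" using u.kap_smult_iff[OF b k c] kap p(1) stc[OF st] xc by simp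
    then show ?thesis unfolding p by (intro linear_relation_smult[OF theta_linear[OF b k] c(1)] theta1[OF st b])
  qed
  have "u.jumps k (Domain H) \<subseteq> u.jumps k (Domain (G k)) \<union> u.jumps k ((\<lambda>s. x \<oplus>\<^bsub>u.U k\<^esub> s) ` Domain (G k))"
  proof
    fix b assume "b \<in> u.jumps k (Domain H)"
    then obtain p q where b: "b \<in> Field r" and pq: "(p, q) \<in> H" and pb: "p \<in> u.A b k" "p \<notin> u.A (u.S b) k"
      unfolding u.jumps_def by blast
    show "b \<in> u.jumps k (Domain (G k)) \<union> u.jumps k ((\<lambda>s. x \<oplus>\<^bsub>u.U k\<^esub> s) ` Domain (G k))"
      using H_cases[OF pq]
    proof (elim disjE exE conjE)
      assume "(p, q) \<in> G k"
      then show ?thesis unfolding u.jumps_def using b pb by blast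
    next
      fix c s t assume c: "c \<in> carrier K" "c \<noteq> \<zero>\<^bsub>K\<^esub>" and st: "(s, t) \<in> G k"
        and p: "p = c \<odot>\<^bsub>u.U k\<^esub> (x \<oplus>\<^bsub>u.U k\<^esub> s)"
      have "x \<oplus>\<^bsub>u.U k\<^esub> s \<in> u.A b k" "x \<oplus>\<^bsub>u.U k\<^esub> s \<notin> u.A (u.S b) k"
        using u.filt_smult_iff[OF k c] stc[OF st] xc pb by (simp_all add: p)
      then show ?thesis unfolding u.jumps_def using b st by blast
    qed
  qed
  moreover have "finite (u.jumps k ((\<lambda>s. x \<oplus>\<^bsub>u.U k\<^esub> s) ` Domain (G k)))"
  proof (rule u.finite_jumps_coset[OF k _ _ xc Gk(5)])
    show "Domain (G k) \<subseteq> carrier (u.U k)" using stc by blast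
    show "s \<ominus>\<^bsub>u.U k\<^esub> s' \<in> Domain (G k)" if "s \<in> Domain (G k)" "s' \<in> Domain (G k)" for s s'
      using that linear_relation_minus[OF u.vs[OF k] v.vs[OF k] lin] by blast
  qed
  ultimately have finH: "finite (u.jumps k (Domain H))" using Gk(5) finite_subset by blast
  have "partial_iso G'"
    unfolding partial_iso_def
  proof (intro allI impI)
    fix j assume j: "j < n"
    show "linear_relation K (u.U j) (v.U j) (G' j) \<and>
     (\<forall>x y. (x, y) \<in> G' j \<longrightarrow> (u.f j x, v.f j y) \<in> G' (u.nx j)) \<and>
     (\<forall>a x y. (x, y) \<in> G' j \<longrightarrow> a \<in> Field r \<longrightarrow> x \<in> u.A a j \<longleftrightarrow> y \<in> v.A a j) \<and>
     (\<forall>a x y. (x, y) \<in> G' j \<longrightarrow> a \<in> Field r \<longrightarrow> x \<in> u.kap a j \<longrightarrow> (x, y) \<in> \<Theta> a j) \<and>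
     finite (u.jumps j (Domain (G' j)))"
    proof (cases "j = k")
      case True
      then have "G' j = H" by (simp add: G'_def)
      then show ?thesis using linH arrowH levelH thetaH finH True by auto
    next
      case False
      then have "G' j = G j" by (simp add: G'_def)
      moreover have "(u.f j x, v.f j y) \<in> G' (u.nx j)" if "(x, y) \<in> G j" for x y
        using partial_isoD(2)[OF G j that] G'sub by blast
      ultimately show ?thesis using partial_isoD[OF G j] by simp
    qed
  qed
  then show thesis using that G'sub xyH by (simp add: G'_def)
qed

text \<open>The image of the partner is prescribed, so the partner is sought among the preimages of
  \<open>z\<close>; the point is to find one whose sums with the range avoid level
  \<open>a + 1\<close>. The vector \<open>x\<close> is then recovered as the difference of
  \<open>w\<close> and an old element of the domain.\<close>

lemma forth_step:
  assumes G: "partial_iso G" and k: "k < n" and x: "x \<in> carrier (u.U k)" and fx: "u.f k x \<in> Domain (G (u.nx k))"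
  obtains G' where "partial_iso G'" "\<And>j. G j \<subseteq> G' j" "x \<in> Domain (G' k)"
proof (cases "x \<in> Domain (G k)")
  case True
  then show thesis using that[OF G] by blast
next
  case False
  interpret U: vectorspace K "u.U k" by (rule u.vs[OF k])
  interpret V: vectorspace K "v.U k" by (rule v.vs[OF k])
  interpret UN: vectorspace K "u.U (u.nx k)" by (rule u.vs[OF u.nx_less])
  interpret VN: vectorspace K "v.U (u.nx k)" by (rule v.vs[OF u.nx_less])
  note Gk = partial_isoD[OF G k] and GN = partial_isoD[OF G u.nx_less[of k]]
  note lin = Gk(1) and linN = GN(1)
  have stc: "s \<in> carrier (u.U k)" "t \<in> carrier (v.U k)" if "(s, t) \<in> G k" for s t
    using linear_relation_carrier[OF lin that] .
  have Dsub: "Domain (G k) \<subseteq> carrier (u.U k)" using stc by blast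
  have Dminus: "s \<ominus>\<^bsub>u.U k\<^esub> s' \<in> Domain (G k)" if "s \<in> Domain (G k)" "s' \<in> Domain (G k)" for s s'
    using that linear_relation_minus[OF u.vs[OF k] v.vs[OF k] lin] by blast
  have D0: "\<zero>\<^bsub>u.U k\<^esub> \<in> Domain (G k)" using linear_relation_zero[OF lin] by blast
  have Dadd: "s \<oplus>\<^bsub>u.U k\<^esub> s' \<in> Domain (G k)" if "s \<in> Domain (G k)" "s' \<in> Domain (G k)" for s s'
    using that linear_relation_add[OF lin] by blast
  \<comment> \<open>A sum lying in every level would be zero and put \<open>x\<close> into the
    domain already; hence every element of the coset has a height.\<close>
  have out: "\<exists>b. x \<oplus>\<^bsub>u.U k\<^esub> s \<notin> u.A b k" if s: "s \<in> Domain (G k)" for s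
  proof (rule ccontr)
    assume "\<nexists>b. x \<oplus>\<^bsub>u.U k\<^esub> s \<notin> u.A b k"
    moreover have sc: "s \<in> carrier (u.U k)" using s Dsub by blast
    ultimately have "x \<oplus>\<^bsub>u.U k\<^esub> s = \<zero>\<^bsub>u.U k\<^esub>" using u_separated[OF k U.M.a_closed[OF x sc]] by blast
    then have "x = \<zero>\<^bsub>u.U k\<^esub> \<ominus>\<^bsub>u.U k\<^esub> s"
      using U.M.minus_equality[OF _ sc x] x sc by (simp add: a_minus_def)
    then show False using False Dminus[OF D0 s] by simp
  qed
  obtain s0 a where s0: "s0 \<in> Domain (G k)" and a: "a \<in> Field r" and s0a: "x \<oplus>\<^bsub>u.U k\<^esub> s0 \<in> u.A a k"
    and proper0: "\<And>s. s \<in> Domain (G k) \<Longrightarrow> x \<oplus>\<^bsub>u.U k\<^esub> s \<notin> u.A (u.S a) k"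
    using u.coset_proper_element[OF k Dsub Dminus _ x Gk(5) out] D0 by blast
  define good where "good w \<longleftrightarrow> (\<exists>s\<in>Domain (G k). w = x \<oplus>\<^bsub>u.U k\<^esub> s) \<and> w \<in> u.A a k" for w
  have good0: "good (x \<oplus>\<^bsub>u.U k\<^esub> s0)" using s0 s0a by (auto simp: good_def)
  \<comment> \<open>An element of maximal height in the coset of \<open>x\<close>, and whose image has height more than \<open>a + 1\<close>
    if possible.\<close>
  obtain w where w: "good w"
    and w_max: "w \<in> u.kap a k \<or> (\<forall>w'. good w' \<longrightarrow> w' \<notin> u.kap a k)"
    using good0 by blast
  obtain s where s: "s \<in> Domain (G k)" and ws: "w = x \<oplus>\<^bsub>u.U k\<^esub> s" and wA: "w \<in> u.A a k"
    using w unfolding good_def by blast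
  have sc: "s \<in> carrier (u.U k)" using s Dsub by blast
  have wc: "w \<in> carrier (u.U k)" by (rule u.filt_carrier[OF k wA])
  have coset: "\<exists>s''\<in>Domain (G k). w \<oplus>\<^bsub>u.U k\<^esub> s' = x \<oplus>\<^bsub>u.U k\<^esub> s''" if s': "s' \<in> Domain (G k)" for s'
    using Dadd[OF s s'] Dsub s' sc x by (auto simp: ws U.M.a_assoc intro!: bexI[of _ "s \<oplus>\<^bsub>u.U k\<^esub> s'"])
  have w_proper: "w \<oplus>\<^bsub>u.U k\<^esub> s' \<notin> u.A (u.S a) k" if s': "s' \<in> Domain (G k)" for s'
  proof -
    obtain s'' where "s'' \<in> Domain (G k)" "w \<oplus>\<^bsub>u.U k\<^esub> s' = x \<oplus>\<^bsub>u.U k\<^esub> s''" using coset[OF s'] ..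
    then show ?thesis using proper0[of s''] by simp
  qed
  have w_notin: "w \<notin> u.A (u.S a) k" using w_proper[OF D0] wc by simp
  have "u.f k w \<in> Domain (G (u.nx k))"
  proof -
    obtain z t where "(u.f k x, z) \<in> G (u.nx k)" "(s, t) \<in> G k" using fx s by blast
    then have "(u.f k x \<oplus>\<^bsub>u.U (u.nx k)\<^esub> u.f k s, z \<oplus>\<^bsub>v.U (u.nx k)\<^esub> v.f k t) \<in> G (u.nx k)"
      by (intro linear_relation_add[OF linN] Gk(2))
    then show ?thesis unfolding ws u.f_add[OF k x sc] by blast
  qed
  then obtain z where wz: "(u.f k w, z) \<in> G (u.nx k)" by blast
  have Sa: "u.S a \<in> Field r" "u.S (u.S a) \<in> Field r" using u.succ_greater[OF a] u.succ_greater(3) by auto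
  have "\<exists>y. y \<in> v.A a k \<and> v.f k y = z \<and> (\<forall>s' t. (s', t) \<in> G k \<longrightarrow> y \<oplus>\<^bsub>v.U k\<^esub> t \<notin> v.A (u.S a) k) \<and>
      (\<forall>s' t. (s', t) \<in> G k \<longrightarrow> w \<oplus>\<^bsub>u.U k\<^esub> s' \<in> u.kap a k \<longrightarrow> (w \<oplus>\<^bsub>u.U k\<^esub> s', y \<oplus>\<^bsub>v.U k\<^esub> t) \<in> \<Theta> a k)"
  proof (cases "w \<in> u.kap a k")
    case True
    \<comment> \<open>A \<Theta>-partner \<open>y0\<close> of \<open>w\<close> has the right class,
      but its image may differ from \<open>z\<close>. Both images lie in level \<open>a + 2\<close>,
      so their difference comes from some \<open>d\<close> in level \<open>a + 1\<close>, and adding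
      \<open>d\<close> leaves the class unchanged.\<close>
    obtain y0 where y0: "(w, y0) \<in> \<Theta> a k" using theta_dom[OF a k True] by blast
    then have y0k: "y0 \<in> v.kap a k" using theta_kap[OF a k] by blast
    have y0A: "y0 \<in> v.A a k" "v.f k y0 \<in> v.A (u.S (u.S a)) (u.nx k)" using y0k by (auto simp: v.kap_def)
    have y0c: "y0 \<in> carrier (v.U k)" by (rule v.filt_carrier[OF k y0A(1)])
    have "u.f k w \<in> u.A (u.S (u.S a)) (u.nx k)" using True by (simp add: u.kap_def)
    then have zA: "z \<in> v.A (u.S (u.S a)) (u.nx k)" using GN(3)[OF wz Sa(2)] by blast
    then have "z \<ominus>\<^bsub>v.U (u.nx k)\<^esub> v.f k y0 \<in> v.f k ` v.A (u.S a) k"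
      using v.filt_minus[OF u.nx_less zA y0A(2)] v.filt_Suc[OF Sa(1) k] by simp
    then obtain d where d: "d \<in> v.A (u.S a) k" "v.f k d = z \<ominus>\<^bsub>v.U (u.nx k)\<^esub> v.f k y0" by auto
    have dc: "d \<in> carrier (v.U k)" by (rule v.filt_carrier[OF k d(1)])
    define y where "y = y0 \<oplus>\<^bsub>v.U k\<^esub> d"
    have yc: "y \<in> carrier (v.U k)" using y0c dc by (simp add: y_def)
    have "(w \<oplus>\<^bsub>u.U k\<^esub> \<zero>\<^bsub>u.U k\<^esub>, y) \<in> \<Theta> a k" unfolding y_def
      by (rule linear_relation_add[OF theta_linear[OF a k] y0 theta_deep[OF a k u.filt_0[OF k] d(1)]])
    then have wy: "(w, y) \<in> \<Theta> a k" using wc by simp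
    have zc: "z \<in> carrier (v.U (u.nx k))" by (rule v.filt_carrier[OF u.nx_less zA])
    have fy: "v.f k y = z"
      using VN.minus_add_cancel[OF zc v.f_closed[OF k y0c]] zc v.f_closed[OF k y0c]
      by (simp add: y_def v.f_add[OF k y0c dc] d(2) VN.M.a_comm)
    have yA: "y \<in> v.A a k" using theta_kap[OF a k wy] by (simp add: v.kap_def)
    have sum: "(w \<oplus>\<^bsub>u.U k\<^esub> s', y \<oplus>\<^bsub>v.U k\<^esub> t) \<in> \<Theta> a k" if st: "(s', t) \<in> G k" and sk: "s' \<in> u.kap a k" for s' t
      by (rule linear_relation_add[OF theta_linear[OF a k] wy Gk(4)[OF st a sk]])
    \<comment> \<open>If \<open>y + t\<close> fell into level \<open>a + 1\<close>, then
      \<open>s'\<close> would lie in \<open>u.kap a k\<close> and \<open>\<Theta>\<close> would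
      relate \<open>w + s'\<close> to \<open>y + t\<close>; since \<Theta>-related vectors agree on
      level \<open>a + 1\<close>, the maximality of \<open>a\<close> would be violated.\<close>
    have "y \<oplus>\<^bsub>v.U k\<^esub> t \<notin> v.A (u.S a) k" if st: "(s', t) \<in> G k" for s' t
    proof
      assume yt: "y \<oplus>\<^bsub>v.U k\<^esub> t \<in> v.A (u.S a) k"
      then have "y \<oplus>\<^bsub>v.U k\<^esub> t \<in> v.kap a k" by (rule v.filt_Suc_kap[OF a k])
      then have "t \<in> v.kap a k"
        using v.kap_add_iff[OF a k conjunct2[OF theta_kap[OF a k wy]] stc(2)[OF st]] by simp
      then have "t \<in> v.A a k" "v.f k t \<in> v.A (u.S (u.S a)) (u.nx k)" by (auto simp: v.kap_def)
      then have "s' \<in> u.kap a k" using Gk(3)[OF st a] GN(3)[OF Gk(2)[OF st] Sa(2)] by (simp add: u.kap_def)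
      then show False using theta_level[OF a k sum[OF st]] yt w_proper st by blast
    qed
    moreover have "(w \<oplus>\<^bsub>u.U k\<^esub> s', y \<oplus>\<^bsub>v.U k\<^esub> t) \<in> \<Theta> a k"
      if st: "(s', t) \<in> G k" and "w \<oplus>\<^bsub>u.U k\<^esub> s' \<in> u.kap a k" for s' t
      using sum[OF st] u.kap_add_iff[OF a k True stc(1)[OF st]] that(2) by simp
    ultimately show ?thesis using yA fy by blast
  next
    case False
    then have no: "w' \<notin> u.kap a k" if "good w'" for w' using w_max that by blast
    have no': "w \<oplus>\<^bsub>u.U k\<^esub> s' \<notin> u.kap a k" if s': "s' \<in> Domain (G k)" for s'
    proof
      assume *: "w \<oplus>\<^bsub>u.U k\<^esub> s' \<in> u.kap a k"
      then have "w \<oplus>\<^bsub>u.U k\<^esub> s' \<in> u.A a k" by (simp add: u.kap_def)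
      then show False using no[of "w \<oplus>\<^bsub>u.U k\<^esub> s'"] coset[OF s'] * unfolding good_def by blast
    qed
    have "u.f k w \<in> u.A (u.S a) (u.nx k)" by (rule u.f_filt[OF a k wA])
    \<comment> \<open>Without a jump in the coset every preimage at level \<open>a\<close> will do:
      a sum \<open>y + t\<close> in level \<open>a + 1\<close> has its image in level
      \<open>a + 2\<close>, hence so has \<open>w + s'\<close>, which would be a jump. Compatibility
      with \<open>\<Theta>\<close> is vacuous here.\<close>
    then have "z \<in> v.f k ` v.A a k" using GN(3)[OF wz Sa(1)] v.filt_Suc[OF a k] by simp
    then obtain y where y: "y \<in> v.A a k" "v.f k y = z" by auto
    have yc: "y \<in> carrier (v.U k)" by (rule v.filt_carrier[OF k y(1)])
    have "y \<oplus>\<^bsub>v.U k\<^esub> t \<notin> v.A (u.S a) k" if st: "(s', t) \<in> G k" for s' t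
    proof
      assume yt: "y \<oplus>\<^bsub>v.U k\<^esub> t \<in> v.A (u.S a) k"
      have "t \<in> v.A a k"
        using v.filt_add_iff[OF k y(1) stc(2)[OF st]] v.filt_Suc_subset[OF a k] yt by blast
      then have "s' \<in> u.A a k" using Gk(3)[OF st a] by simp
      then have "w \<oplus>\<^bsub>u.U k\<^esub> s' \<in> u.A a k" by (rule u.filt_add[OF k wA])
      moreover have "u.f k (w \<oplus>\<^bsub>u.U k\<^esub> s') \<in> u.A (u.S (u.S a)) (u.nx k)"
      proof -
        have "v.f k (y \<oplus>\<^bsub>v.U k\<^esub> t) \<in> v.A (u.S (u.S a)) (u.nx k)" by (rule v.f_filt[OF Sa(1) k yt])
        then have "z \<oplus>\<^bsub>v.U (u.nx k)\<^esub> v.f k t \<in> v.A (u.S (u.S a)) (u.nx k)"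
          using v.f_add[OF k yc stc(2)[OF st]] y(2) by simp
        then have "u.f k w \<oplus>\<^bsub>u.U (u.nx k)\<^esub> u.f k s' \<in> u.A (u.S (u.S a)) (u.nx k)"
          using GN(3)[OF linear_relation_add[OF linN wz Gk(2)[OF st]] Sa(2)] by simp
        then show ?thesis using u.f_add[OF k wc stc(1)[OF st]] by simp
      qed
      ultimately have "w \<oplus>\<^bsub>u.U k\<^esub> s' \<in> u.kap a k" by (simp add: u.kap_def)
      then show False using no' st by blast
    qed
    then show ?thesis using y no' by blast
  qed
  then obtain y where y: "y \<in> v.A a k" "v.f k y = z"
    and y_proper: "\<And>s' t. (s', t) \<in> G k \<Longrightarrow> y \<oplus>\<^bsub>v.U k\<^esub> t \<notin> v.A (u.S a) k"
    and compat: "\<And>s' t. (s', t) \<in> G k \<Longrightarrow> w \<oplus>\<^bsub>u.U k\<^esub> s' \<in> u.kap a k \<Longrightarrow> (w \<oplus>\<^bsub>u.U k\<^esub> s', y \<oplus>\<^bsub>v.U k\<^esub> t) \<in> \<Theta> a k"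
    by blast
  have fwy: "(u.f k w, v.f k y) \<in> G (u.nx k)" using wz y(2) by simp
  have "\<exists>G'. partial_iso G' \<and> (\<forall>j. G j \<subseteq> G' j) \<and> (w, y) \<in> G' k"
  proof (rule extend_partial_iso[OF G k a wA y(1) fwy])
    show "w \<oplus>\<^bsub>u.U k\<^esub> s' \<notin> u.A (u.S a) k" if "(s', t) \<in> G k" for s' t by (rule w_proper) (use that in blast)
    show "y \<oplus>\<^bsub>v.U k\<^esub> t \<notin> v.A (u.S a) k" if "(s', t) \<in> G k" for s' t using that by (rule y_proper)
    show "(w \<oplus>\<^bsub>u.U k\<^esub> s', y \<oplus>\<^bsub>v.U k\<^esub> t) \<in> \<Theta> a k"
      if "(s', t) \<in> G k" "w \<oplus>\<^bsub>u.U k\<^esub> s' \<in> u.kap a k" for s' t using that by (rule compat)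
  qed blast
  then obtain G' where G': "partial_iso G'" "\<And>j. G j \<subseteq> G' j" "(w, y) \<in> G' k" by blast
  have "w \<ominus>\<^bsub>u.U k\<^esub> s \<in> Domain (G' k)"
    using linear_relation_minus[OF u.vs[OF k] v.vs[OF k] partial_isoD(1)[OF G'(1) k] G'(3)] G'(2)[of k] s by blast
  moreover have "w \<ominus>\<^bsub>u.U k\<^esub> s = x" unfolding ws using x sc by (simp add: a_minus_def U.M.a_assoc U.M.r_neg)
  ultimately show thesis using that G'(1,2) by simp
qed

end

section \<open>Paths of arrows and local nilpotence\<close>

context cyclic_filtration
begin

lemma arrow_path_add: "arrow_path n u k (i + j) x = arrow_path n u ((k + i) mod n) j (arrow_path n u k i x)"
  by (induction j) (simp_all add: mod_add_left_eq add.assoc)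

lemma arrow_path_Suc: "k < n \<Longrightarrow> arrow_path n u k (Suc m) x = arrow_path n u (nx k) m (f k x)"
  using arrow_path_add[of k 1 m x] by (simp add: cnext_def)

lemma arrow_path_closed:
  "k < n \<Longrightarrow> x \<in> carrier (U k) \<Longrightarrow> arrow_path n u k m x \<in> carrier (U ((k + m) mod n))"
proof (induction m)
  case (Suc m)
  have "nx ((k + m) mod n) = (k + Suc m) mod n" by (simp add: cnext_def mod_Suc_eq)
  then show ?case using f_closed[of "(k + m) mod n"] Suc n by simp
qed simp

lemma cycle_map_pow: "(cycle_map n u 0 ^^ i) x = arrow_path n u 0 (n * i) x"
proof (induction i)
  case (Suc i)
  then show ?case using arrow_path_add[of 0 "n * i" n x] by (simp add: cycle_map_def add.commute)
qed simp

text \<open>Nilpotence is stated at vertex 0 only. The \<open>n - k\<close> arrows from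
  \<open>k\<close> lead there (a full turn if \<open>k = 0\<close>), and whole cycles
  follow.\<close>

lemma locally_nilpotent_path:
  assumes "locally_nilpotent n u" "k < n" "x \<in> carrier (U k)"
  shows "\<exists>m. arrow_path n u k m x = \<zero>\<^bsub>U ((k + m) mod n)\<^esub>"
proof -
  let ?y = "arrow_path n u k (n - k) x"
  have "(k + (n - k)) mod n = 0" using assms(2) by simp
  then have "?y \<in> carrier (U 0)" using arrow_path_closed[OF assms(2,3), of "n - k"] by simp
  then obtain i where "(cycle_map n u 0 ^^ i) ?y = \<zero>\<^bsub>U 0\<^esub>"
    using assms(1) unfolding locally_nilpotent_def by blast
  then have "arrow_path n u k (n - k + n * i) x = \<zero>\<^bsub>U 0\<^esub>"
    using assms(2) unfolding arrow_path_add cycle_map_pow by simp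
  moreover have "(k + (n - k + n * i)) mod n = 0" using assms(2) by simp
  ultimately show ?thesis by metis
qed

end

text \<open>Serves to compare domains with spans: a domain that contains a basis is the whole
  space.\<close>

lemma linear_relation_Domain:
  assumes "vectorspace K V" "linear_relation K V W G"
  shows "submodule K (Domain G) V"
proof (rule submodule.intro)
  show "module K V" using assms(1) by (simp add: vectorspace_def)
  show "Domain G \<subseteq> carrier V" using linear_relation_carrier(1)[OF assms(2)] by blast
  show "\<zero>\<^bsub>V\<^esub> \<in> Domain G" using linear_relation_zero[OF assms(2)] by blast
  show "x \<oplus>\<^bsub>V\<^esub> y \<in> Domain G" if "x \<in> Domain G" "y \<in> Domain G" for x y
    using that linear_relation_add[OF assms(2)] by blast
  show "c \<odot>\<^bsub>V\<^esub> x \<in> Domain G" if "c \<in> carrier K" "x \<in> Domain G" for c x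
    using that linear_relation_smult[OF assms(2)] by blast
qed

section \<open>The back-and-forth construction\<close>

context filtration_pair
begin

text \<open>An extension step wants the image of the new vector in the domain already. On the path
  of \<open>x\<close> this holds at the far end, where zero is reached, so the path is adjoined
  backwards from there.\<close>

lemma extend_domain:
  assumes "partial_iso G" "k < n" "x \<in> carrier (u.U k)" "arrow_path n u k m x = \<zero>\<^bsub>u.U ((k + m) mod n)\<^esub>"
  shows "\<exists>G'. partial_iso G' \<and> (\<forall>j. G j \<subseteq> G' j) \<and> x \<in> Domain (G' k)"
  using assms
proof (induction m arbitrary: k x)
  case 0
  then have "x = \<zero>\<^bsub>u.U k\<^esub>" by simp
  then have "x \<in> Domain (G k)" using linear_relation_zero[OF partial_isoD(1)[OF 0(1,2)]] by blast
  then show ?case using 0(1) by blast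
next
  case (Suc m)
  have idx: "(u.nx k + m) mod n = (k + Suc m) mod n" by (simp add: cnext_def mod_add_left_eq)
  have "arrow_path n u (u.nx k) m (u.f k x) = \<zero>\<^bsub>u.U ((u.nx k + m) mod n)\<^esub>"
    using Suc.prems(4) unfolding u.arrow_path_Suc[OF Suc.prems(2)] idx .
  then obtain G1 where G1: "partial_iso G1" "\<forall>j. G j \<subseteq> G1 j" "u.f k x \<in> Domain (G1 (u.nx k))"
    using Suc.IH[OF Suc.prems(1) u.nx_less u.f_closed[OF Suc.prems(2,3)]] by blast
  obtain G2 where "partial_iso G2" "\<And>j. G1 j \<subseteq> G2 j" "x \<in> Domain (G2 k)"
    using forth_step[OF G1(1) Suc.prems(2,3) G1(3)] by blast
  then show ?case using G1(2) by (intro exI[of _ G2]) blast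
qed

text \<open>The conditions of \<open>partial_iso\<close> on \<open>\<Theta>\<close> and on heights
  are put on the side of \<open>u\<close>; equality of levels, at \<open>k\<close> and at the next
  vertex, carries them over to \<open>v\<close>.\<close>

lemma partial_iso_converse:
  assumes "partial_iso G"
  shows "filtration_pair.partial_iso r K n v u (\<lambda>a k. (\<Theta> a k)\<inverse>) (\<lambda>k. (G k)\<inverse>)"
proof -
  interpret c: filtration_pair r K n v u "\<lambda>a k. (\<Theta> a k)\<inverse>" by (rule filtration_pair_converse)
  show ?thesis
    unfolding c.partial_iso_def
  proof (intro allI impI conjI)
    fix k assume k: "k < n"
    note G = partial_isoD[OF assms k]
    show "linear_relation K (v.U k) (u.U k) ((G k)\<inverse>)" by (rule linear_relation_converse[OF G(1)])
    show "(v.f k y, u.f k x) \<in> (G (u.nx k))\<inverse>" if "(y, x) \<in> (G k)\<inverse>" for x y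
      using G(2) that by blast
    show "y \<in> v.A a k \<longleftrightarrow> x \<in> u.A a k" if "(y, x) \<in> (G k)\<inverse>" "a \<in> Field r" for a x y
      using G(3) that by blast
    show "(y, x) \<in> (\<Theta> a k)\<inverse>" if yx: "(y, x) \<in> (G k)\<inverse>" "a \<in> Field r" "y \<in> v.kap a k" for a x y
    proof -
      have xy: "(x, y) \<in> G k" using yx(1) by simp
      have "u.S (u.S a) \<in> Field r" using u.succ_greater(3) yx(2) by blast
      then have "x \<in> u.kap a k"
        using yx(3) G(3)[OF xy yx(2)] partial_isoD(3)[OF assms u.nx_less G(2)[OF xy]]
        by (simp add: u.kap_def v.kap_def)
      then show ?thesis using G(4)[OF xy yx(2)] by simp
    qed
    have "v.jumps k (Domain ((G k)\<inverse>)) \<subseteq> u.jumps k (Domain (G k))"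
    proof
      fix a assume "a \<in> v.jumps k (Domain ((G k)\<inverse>))"
      then obtain x y where xy: "(x, y) \<in> G k" and a: "a \<in> Field r" "y \<in> v.A a k" "y \<notin> v.A (u.S a) k"
        unfolding v.jumps_def by blast
      have "x \<in> u.A a k" "x \<notin> u.A (u.S a) k"
        using G(3)[OF xy a(1)] G(3)[OF xy u.succ_greater(3)[OF a(1)]] a(2,3) by simp_all
      then show "a \<in> u.jumps k (Domain (G k))" unfolding u.jumps_def using a(1) xy by blast
    qed
    then show "finite (v.jumps k (Domain ((G k)\<inverse>)))" using G(5) finite_subset by blast
  qed
qed

lemma extend_range:
  assumes "partial_iso G" "k < n" "y \<in> carrier (v.U k)" "arrow_path n v k m y = \<zero>\<^bsub>v.U ((k + m) mod n)\<^esub>"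
  shows "\<exists>G'. partial_iso G' \<and> (\<forall>j. G j \<subseteq> G' j) \<and> y \<in> Range (G' k)"
proof -
  interpret c: filtration_pair r K n v u "\<lambda>a k. (\<Theta> a k)\<inverse>" by (rule filtration_pair_converse)
  obtain G' where G': "c.partial_iso G'" "\<forall>j. (G j)\<inverse> \<subseteq> G' j" "y \<in> Domain (G' k)"
    using c.extend_domain[OF partial_iso_converse[OF assms(1)] assms(2-4)] by blast
  have "partial_iso (\<lambda>k. (G' k)\<inverse>)" using c.partial_iso_converse[OF G'(1)] by simp
  moreover have "G j \<subseteq> (G' j)\<inverse>" for j using G'(2) converse_subset_swap by blast
  moreover have "y \<in> Range ((G' k)\<inverse>)" using G'(3) by simp
  ultimately show ?thesis by (intro exI[of _ "\<lambda>k. (G' k)\<inverse>"]) blast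
qed

lemma partial_iso_zero: "partial_iso (\<lambda>k. {(\<zero>\<^bsub>u.U k\<^esub>, \<zero>\<^bsub>v.U k\<^esub>)})"
  unfolding partial_iso_def
proof (intro allI impI conjI)
  fix k assume k: "k < n"
  interpret U: vectorspace K "u.U k" by (rule u.vs[OF k])
  interpret V: vectorspace K "v.U k" by (rule v.vs[OF k])
  show "linear_relation K (u.U k) (v.U k) {(\<zero>\<^bsub>u.U k\<^esub>, \<zero>\<^bsub>v.U k\<^esub>)}"
    by (auto simp: linear_relation_def)
  show "(u.f k x, v.f k y) \<in> {(\<zero>\<^bsub>u.U (u.nx k)\<^esub>, \<zero>\<^bsub>v.U (u.nx k)\<^esub>)}"
    if "(x, y) \<in> {(\<zero>\<^bsub>u.U k\<^esub>, \<zero>\<^bsub>v.U k\<^esub>)}" for x y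
    using that k by (simp add: u.f_zero v.f_zero)
  show "x \<in> u.A a k \<longleftrightarrow> y \<in> v.A a k" if "(x, y) \<in> {(\<zero>\<^bsub>u.U k\<^esub>, \<zero>\<^bsub>v.U k\<^esub>)}" for a x y
    using that k by (simp add: u.filt_0 v.filt_0)
  show "(x, y) \<in> \<Theta> a k" if "(x, y) \<in> {(\<zero>\<^bsub>u.U k\<^esub>, \<zero>\<^bsub>v.U k\<^esub>)}" "a \<in> Field r" for a x y
    using that linear_relation_zero[OF theta_linear[OF that(2) k]] by simp
  have "u.jumps k (Domain {(\<zero>\<^bsub>u.U k\<^esub>, \<zero>\<^bsub>v.U k\<^esub>)}) = {}"
    unfolding u.jumps_def using u.filt_0[OF k] by simp
  then show "finite (u.jumps k (Domain {(\<zero>\<^bsub>u.U k\<^esub>, \<zero>\<^bsub>v.U k\<^esub>)}))" by simp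
qed

lemma back_and_forth_chain:
  assumes E: "countable E" "\<And>k x. (k, x) \<in> E \<Longrightarrow> k < n \<and> x \<in> carrier (u.U k)"
    and F: "countable F" "\<And>k y. (k, y) \<in> F \<Longrightarrow> k < n \<and> y \<in> carrier (v.U k)"
    and nil: "locally_nilpotent n u" "locally_nilpotent n v"
  obtains g :: "nat \<Rightarrow> nat \<Rightarrow> ('a \<times> 'b) set" where "\<And>i. partial_iso (g i)" "\<And>i j k. i \<le> j \<Longrightarrow> g i k \<subseteq> g j k"
    "\<And>k x. (k, x) \<in> E \<Longrightarrow> \<exists>i. x \<in> Domain (g i k)" "\<And>k y. (k, y) \<in> F \<Longrightarrow> \<exists>i. y \<in> Range (g i k)"
proof -
  define met :: "(nat \<times> 'a) + (nat \<times> 'b) \<Rightarrow> (nat \<Rightarrow> ('a \<times> 'b) set) \<Rightarrow> bool" where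
    "met q G = (case q of Inl (k, x) \<Rightarrow> x \<in> Domain (G k) | Inr (k, y) \<Rightarrow> y \<in> Range (G k))" for q G
  \<comment> \<open>The tasks: vectors to be put into the domain (\<open>Inl\<close>) or the range
    (\<open>Inr\<close>). The zero vector is added to keep the set nonempty, as
    \<open>from_nat_into\<close> requires.\<close>
  define Q where "Q = insert (Inl (0, \<zero>\<^bsub>u.U 0\<^esub>)) (Inl ` E \<union> Inr ` F)"
  have Q: "countable Q" "Q \<noteq> {}" using E(1) F(1) by (auto simp: Q_def)
  have step: "\<exists>G'. partial_iso G' \<and> (\<forall>j. G j \<subseteq> G' j) \<and> met q G'" if G: "partial_iso G" and q: "q \<in> Q" for G q
  proof -
    have z: "\<zero>\<^bsub>u.U 0\<^esub> \<in> carrier (u.U 0)" using u.filt_carrier[OF u.n u.filt_0[OF u.n]] .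
    consider k x where "q = Inl (k, x)" "k < n" "x \<in> carrier (u.U k)"
      | k y where "q = Inr (k, y)" "k < n" "y \<in> carrier (v.U k)"
      using q z u.n E(2) F(2) unfolding Q_def by fastforce
    then show ?thesis
    proof cases
      case (1 k x)
      then show ?thesis
        using extend_domain[OF G 1(2,3)] u.locally_nilpotent_path[OF nil(1) 1(2,3)] by (auto simp: met_def)
    next
      case (2 k y)
      then show ?thesis
        using extend_range[OF G 2(2,3)] v.locally_nilpotent_path[OF nil(2) 2(2,3)] by (auto simp: met_def)
    qed
  qed
  \<comment> \<open>Step \<open>i\<close> carries out task \<open>i\<close>. Domains and ranges only
    grow, so a task once done stays done.\<close>
  have "\<exists>g. \<forall>i. partial_iso (g i) \<and> ((\<forall>j. g i j \<subseteq> g (Suc i) j) \<and> met (from_nat_into Q i) (g (Suc i)))"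
  proof (rule dependent_nat_choice)
    show "\<exists>G. partial_iso G" using partial_iso_zero by blast
    show "\<exists>G'. partial_iso G' \<and> (\<forall>j. G j \<subseteq> G' j) \<and> met (from_nat_into Q i) G'" if "partial_iso G" for G i
      using step[OF that from_nat_into[OF Q(2)]] .
  qed
  then obtain g where g: "\<And>i. partial_iso (g i)" "\<And>i k. g i k \<subseteq> g (Suc i) k"
    "\<And>i. met (from_nat_into Q i) (g (Suc i))" by blast
  have met: "\<exists>i. met q (g i)" if "q \<in> Q" for q
    using g(3) from_nat_into_surj[OF Q(1) that] by metis
  show thesis
  proof (rule that[of g])
    show "partial_iso (g i)" for i by (rule g(1))
    show "g i k \<subseteq> g j k" if "i \<le> j" for i j k
      using lift_Suc_mono_le[of "\<lambda>i. g i k", OF g(2) that] .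
    show "\<exists>i. x \<in> Domain (g i k)" if "(k, x) \<in> E" for k x
      using met[of "Inl (k, x)"] that by (simp add: Q_def met_def)
    show "\<exists>i. y \<in> Range (g i k)" if "(k, y) \<in> F" for k y
      using met[of "Inr (k, y)"] that by (simp add: Q_def met_def)
  qed
qed

text \<open>Only basis vectors are made tasks. The union of the chain is a linear relation, so its
  domain and range are subspaces; containing bases, they are everything.\<close>

lemma isomorphic_if_countable:
  assumes B: "\<And>k. k < n \<Longrightarrow> countable (B k) \<and> vectorspace.basis K (u.U k) (B k)"
    and C: "\<And>k. k < n \<Longrightarrow> countable (C k) \<and> vectorspace.basis K (v.U k) (C k)"
    and nil: "locally_nilpotent n u" "locally_nilpotent n v"
  shows "isomorphic_reps K n u v"
proof -
  have Bc: "B k \<subseteq> carrier (u.U k)" "module.span K (u.U k) (B k) = carrier (u.U k)" if "k < n" for k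
    using B[OF that] vectorspace.basis_def[OF u.vs[OF that]] by auto
  have Cc: "C k \<subseteq> carrier (v.U k)" "module.span K (v.U k) (C k) = carrier (v.U k)" if "k < n" for k
    using C[OF that] vectorspace.basis_def[OF v.vs[OF that]] by auto
  have cnt: "countable (Sigma {..<n} B)" "countable (Sigma {..<n} C)" using B C by auto
  have E: "k < n \<and> x \<in> carrier (u.U k)" if "(k, x) \<in> Sigma {..<n} B" for k x using that Bc by auto
  have F: "k < n \<and> y \<in> carrier (v.U k)" if "(k, y) \<in> Sigma {..<n} C" for k y using that Cc by auto
  obtain g :: "nat \<Rightarrow> nat \<Rightarrow> ('a \<times> 'b) set" where g: "\<And>i. partial_iso (g i)" "\<And>i j k. i \<le> j \<Longrightarrow> g i k \<subseteq> g j k"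
    and gE: "\<And>k x. (k, x) \<in> Sigma {..<n} B \<Longrightarrow> \<exists>i. x \<in> Domain (g i k)"
    and gF: "\<And>k y. (k, y) \<in> Sigma {..<n} C \<Longrightarrow> \<exists>i. y \<in> Range (g i k)"
    using back_and_forth_chain[OF cnt(1) E cnt(2) F nil] by blast
  define H where "H k = (\<Union>i. g i k)" for k
  \<comment> \<open>The chain is increasing at each vertex, so two pairs of the union occur together
    in one member.\<close>
  have H_two: "\<exists>i. (x, y) \<in> g i k \<and> (x', y') \<in> g i k" if "(x, y) \<in> H k" "(x', y') \<in> H k" for k x y x' y'
  proof -
    obtain i j where "(x, y) \<in> g i k" "(x', y') \<in> g j k" using \<open>(x, y) \<in> H k\<close> \<open>(x', y') \<in> H k\<close> unfolding H_def by blast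
    then show ?thesis using g(2)[of i "max i j" k] g(2)[of j "max i j" k] by auto
  qed
  have H: "linear_relation K (u.U k) (v.U k) (H k)" if k: "k < n" for k
    unfolding linear_relation_def
  proof (intro conjI allI impI)
    note lin = partial_isoD(1)[OF g(1) k]
    show "H k \<subseteq> carrier (u.U k) \<times> carrier (v.U k)"
      unfolding H_def using linear_relation_carrier[OF lin] by (intro UN_least subrelI) blast
    show "(\<zero>\<^bsub>u.U k\<^esub>, \<zero>\<^bsub>v.U k\<^esub>) \<in> H k" unfolding H_def using linear_relation_zero[OF lin] by blast
    show "(x \<oplus>\<^bsub>u.U k\<^esub> x', y \<oplus>\<^bsub>v.U k\<^esub> y') \<in> H k" if xy: "(x, y) \<in> H k" "(x', y') \<in> H k" for x y x' y'
      using H_two[OF xy] linear_relation_add[OF lin] unfolding H_def by blast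
    show "(c \<odot>\<^bsub>u.U k\<^esub> x, c \<odot>\<^bsub>v.U k\<^esub> y) \<in> H k" if xy: "c \<in> carrier K" "(x, y) \<in> H k" for c x y
      using xy linear_relation_smult[OF lin] unfolding H_def by blast
  qed
  have arrow: "(u.f k x, v.f k y) \<in> H (u.nx k)" if "k < n" "(x, y) \<in> H k" for k x y
    using partial_isoD(2)[OF g(1) that(1)] that(2) unfolding H_def by blast
  have level: "x \<in> u.A a k \<longleftrightarrow> y \<in> v.A a k" if k: "k < n" and xy: "(x, y) \<in> H k" for k x y a
  proof (cases "a \<in> Field r")
    case True
    obtain i where "(x, y) \<in> g i k" using xy unfolding H_def by blast
    then show ?thesis using partial_isoD(3)[OF g(1) k _ True] by blast
  next
    case False
    \<comment> \<open>Outside the field both levels are whole spaces. The case matters because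
      separatedness quantifies over all \<open>a\<close> of the type.\<close>
    then have "underS r a = {}" by (auto simp: underS_def Field_def)
    then show ?thesis
      using filt_zero[OF u.Well_order, of a n u k] filt_zero[OF u.Well_order, of a n v k]
        linear_relation_carrier[OF H[OF k] xy] by simp
  qed
  have dom: "x \<in> Domain (H k)" if k: "k < n" and x: "x \<in> carrier (u.U k)" for k x
  proof -
    interpret vectorspace K "u.U k" by (rule u.vs[OF k])
    have "B k \<subseteq> Domain (H k)" using gE k unfolding H_def by blast
    then show ?thesis using span_is_subset[OF _ linear_relation_Domain[OF u.vs[OF k] H[OF k]]] Bc(2)[OF k] x by blast
  qed
  have ran: "y \<in> Domain ((H k)\<inverse>)" if k: "k < n" and y: "y \<in> carrier (v.U k)" for k y
  proof -
    interpret vectorspace K "v.U k" by (rule v.vs[OF k])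
    have "C k \<subseteq> Domain ((H k)\<inverse>)" using gF k unfolding H_def by blast
    then show ?thesis
      using span_is_subset[OF _ linear_relation_Domain[OF v.vs[OF k] linear_relation_converse[OF H[OF k]]]]
        Cc(2)[OF k] y by blast
  qed
  have "\<exists>T. linear_map K (u.U k) (v.U k) T \<and> bij_betw T (carrier (u.U k)) (carrier (v.U k)) \<and>
      (\<forall>x y. (x, y) \<in> H k \<longleftrightarrow> x \<in> carrier (u.U k) \<and> y = T x)" if k: "k < n" for k
  proof (rule linear_relation_bij[OF u.vs[OF k] v.vs[OF k] H[OF k]])
    show "\<exists>y. (x, y) \<in> H k" if "x \<in> carrier (u.U k)" for x using dom[OF k that] by blast
    show "\<exists>x. (x, y) \<in> H k" if "y \<in> carrier (v.U k)" for y using ran[OF k that] by blast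
    show "x = \<zero>\<^bsub>u.U k\<^esub> \<longleftrightarrow> y = \<zero>\<^bsub>v.U k\<^esub>" if xy: "(x, y) \<in> H k" for x y
    proof
      note c = linear_relation_carrier[OF H[OF k] xy]
      \<comment> \<open>A partner of zero lies in every level, as zero does, and is zero by
        separatedness.\<close>
      show "y = \<zero>\<^bsub>v.U k\<^esub>" if "x = \<zero>\<^bsub>u.U k\<^esub>"
        using v_separated[OF k c(2)] level[OF k xy] u.filt_0[OF k] that by blast
      show "x = \<zero>\<^bsub>u.U k\<^esub>" if "y = \<zero>\<^bsub>v.U k\<^esub>"
        using u_separated[OF k c(1)] level[OF k xy] v.filt_0[OF k] that by blast
    qed
  qed blast
  then obtain \<phi> where \<phi>: "\<And>k. k < n \<Longrightarrow> linear_map K (u.U k) (v.U k) (\<phi> k)"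
    "\<And>k. k < n \<Longrightarrow> bij_betw (\<phi> k) (carrier (u.U k)) (carrier (v.U k))"
    "\<And>k x y. k < n \<Longrightarrow> (x, y) \<in> H k \<longleftrightarrow> x \<in> carrier (u.U k) \<and> y = \<phi> k x"
    by metis
  have "v.f k (\<phi> k x) = \<phi> (u.nx k) (u.f k x)" if k: "k < n" and x: "x \<in> carrier (u.U k)" for k x
  proof -
    have "(x, \<phi> k x) \<in> H k" using \<phi>(3)[OF k] x by simp
    then have "(u.f k x, v.f k (\<phi> k x)) \<in> H (u.nx k)" by (rule arrow[OF k])
    then show ?thesis using \<phi>(3)[OF u.nx_less] by simp
  qed
  then show ?thesis unfolding isomorphic_reps_def using \<phi>(1,2) by blast
qed

end

section \<open>Kaplansky invariants under isomorphism\<close>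

text \<open>Turns an equality of cardinals into the data of \<open>filtration_pair\<close>: an
  isomorphism of the kernels is lifted to pairs of vectors whose cosets correspond. Vectors of level
  \<open>a + 1\<close> have the zero coset, so all pairs of them are related.\<close>

lemma theta_exists:
  assumes u: "cyclic_filtration r K n u" and v: "cyclic_filtration r K n v"
    and a: "a \<in> Field r" and k: "k < n"
    and eq: "kaplansky_inv K n u r k a =o kaplansky_inv K n v r k a"
  obtains T where "linear_relation K (space_at u k) (space_at v k) T"
    "T \<subseteq> cyclic_filtration.kap r n u a k \<times> cyclic_filtration.kap r n v a k"
    "cyclic_filtration.kap r n u a k \<subseteq> Domain T" "cyclic_filtration.kap r n v a k \<subseteq> Range T"
    "\<And>x y. (x, y) \<in> T \<Longrightarrow> x \<in> filt n u r (ord_succ r a) k \<longleftrightarrow> y \<in> filt n v r (ord_succ r a) k"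
    "filt n u r (ord_succ r a) k \<times> filt n v r (ord_succ r a) k \<subseteq> T"
proof -
  interpret u: cyclic_filtration r K n u by fact
  interpret v: cyclic_filtration r K n v by fact
  define Q where "Q = filt_quot n u r k a
      \<lparr>carrier := a_kernel (filt_quot n u r k a) (filt_quot n u r (u.nx k) (u.S a)) (induced_arrow n u r k a)\<rparr>"
  define R where "R = filt_quot n v r k a
      \<lparr>carrier := a_kernel (filt_quot n v r k a) (filt_quot n v r (u.nx k) (u.S a)) (induced_arrow n v r k a)\<rparr>"
  define p where "p = (\<lambda>x. u.A (u.S a) k +>\<^bsub>u.U k\<^esub> x)"
  define q where "q = (\<lambda>x. v.A (u.S a) k +>\<^bsub>v.U k\<^esub> x)"
  note Q = u.kaplansky_space[OF a k, folded Q_def p_def] and R = v.kaplansky_space[OF a k, folded R_def q_def]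
  have "vdim K Q =o vdim K R" using eq unfolding kaplansky_inv_def Q_def R_def .
  then obtain t where t: "linear_map K Q R t" "bij_betw t (carrier Q) (carrier R)"
    using vdim_ordIso_iff[OF Q(1) R(1)] by blast
  interpret t: linear_map K Q R t by (rule t(1))
  define T where "T = {(x, y). x \<in> u.kap a k \<and> y \<in> v.kap a k \<and> t (p x) = q y}"
  have pQ: "p x \<in> carrier Q" if "x \<in> u.kap a k" for x using Q(2) that by blast
  have inj: "t X = t Y \<longleftrightarrow> X = Y" if "X \<in> carrier Q" "Y \<in> carrier Q" for X Y
    using t(2) that unfolding bij_betw_def by (blast dest: inj_onD)
  have lin: "linear_relation K (u.U k) (v.U k) T"
    unfolding linear_relation_def
  proof (intro conjI allI impI)
    interpret ku: submodule K "u.kap a k" "u.U k" by (rule Q(6))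
    interpret kv: submodule K "v.kap a k" "v.U k" by (rule R(6))
    show "T \<subseteq> carrier (u.U k) \<times> carrier (v.U k)" using ku.subset kv.subset unfolding T_def by blast
    have "p \<zero>\<^bsub>u.U k\<^esub> = \<zero>\<^bsub>Q\<^esub>" "q \<zero>\<^bsub>v.U k\<^esub> = \<zero>\<^bsub>R\<^esub>"
      using Q(5)[OF ku.zero_closed] R(5)[OF kv.zero_closed] u.filt_0[OF k] v.filt_0[OF k] by blast+
    then show "(\<zero>\<^bsub>u.U k\<^esub>, \<zero>\<^bsub>v.U k\<^esub>) \<in> T" by (simp add: T_def)
    show "(x \<oplus>\<^bsub>u.U k\<^esub> x', y \<oplus>\<^bsub>v.U k\<^esub> y') \<in> T" if "(x, y) \<in> T" "(x', y') \<in> T" for x y x' y'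
    proof -
      have x: "x \<in> u.kap a k" "x' \<in> u.kap a k" and y: "y \<in> v.kap a k" "y' \<in> v.kap a k"
        and eq: "t (p x) = q y" "t (p x') = q y'" using that by (simp_all add: T_def)
      have "t (p (x \<oplus>\<^bsub>u.U k\<^esub> x')) = q (y \<oplus>\<^bsub>v.U k\<^esub> y')"
        unfolding Q(3)[OF x, symmetric] R(3)[OF y, symmetric] eq[symmetric] by (rule t.f_add[OF pQ pQ, OF x])
      then show ?thesis using ku.m_closed[OF x] kv.m_closed[OF y] by (simp add: T_def)
    qed
    show "(c \<odot>\<^bsub>u.U k\<^esub> x, c \<odot>\<^bsub>v.U k\<^esub> y) \<in> T" if "c \<in> carrier K" "(x, y) \<in> T" for c x y
    proof -
      have x: "x \<in> u.kap a k" and y: "y \<in> v.kap a k" and eq: "t (p x) = q y" using that(2) by (simp_all add: T_def)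
      have "t (p (c \<odot>\<^bsub>u.U k\<^esub> x)) = q (c \<odot>\<^bsub>v.U k\<^esub> y)"
        unfolding Q(4)[OF that(1) x, symmetric] R(4)[OF that(1) y, symmetric] eq[symmetric]
        by (rule t.f_smult[OF that(1) pQ[OF x]])
      then show ?thesis using ku.smult_closed[OF that(1) x] kv.smult_closed[OF that(1) y] by (simp add: T_def)
    qed
  qed
  have level: "x \<in> u.A (u.S a) k \<longleftrightarrow> y \<in> v.A (u.S a) k" if "(x, y) \<in> T" for x y
  proof -
    have xy: "x \<in> u.kap a k" "y \<in> v.kap a k" "t (p x) = q y" using that by (auto simp: T_def)
    have "q y = \<zero>\<^bsub>R\<^esub> \<longleftrightarrow> p x = \<zero>\<^bsub>Q\<^esub>"
      using inj[OF pQ[OF xy(1)], of "\<zero>\<^bsub>Q\<^esub>"] xy(3) by simp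
    then show ?thesis using Q(5)[OF xy(1)] R(5)[OF xy(2)] by simp
  qed
  have surj: "t ` p ` u.kap a k = q ` v.kap a k"
    using t(2) unfolding bij_betw_def Q(2) R(2) by blast
  have "u.kap a k \<subseteq> Domain T"
  proof
    fix x assume x: "x \<in> u.kap a k"
    then have "t (p x) \<in> q ` v.kap a k" unfolding surj[symmetric] by blast
    then show "x \<in> Domain T" using x unfolding T_def by auto
  qed
  moreover have "v.kap a k \<subseteq> Range T"
  proof
    fix y assume y: "y \<in> v.kap a k"
    then have "q y \<in> t ` p ` u.kap a k" unfolding surj by blast
    then obtain x where "x \<in> u.kap a k" "t (p x) = q y" by auto
    then show "y \<in> Range T" using y unfolding T_def by blast
  qed
  moreover have "u.A (u.S a) k \<times> v.A (u.S a) k \<subseteq> T"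
  proof
    fix z assume "z \<in> u.A (u.S a) k \<times> v.A (u.S a) k"
    then obtain x y where z: "z = (x, y)" and x: "x \<in> u.A (u.S a) k" and y: "y \<in> v.A (u.S a) k" by blast
    have xk: "x \<in> u.kap a k" and yk: "y \<in> v.kap a k"
      using u.filt_Suc_kap[OF a k x] v.filt_Suc_kap[OF a k y] .
    then have "t (p x) = q y" using Q(5)[OF xk] R(5)[OF yk] x y by simp
    then show "z \<in> T" using xk yk by (simp add: T_def z)
  qed
  moreover have "T \<subseteq> u.kap a k \<times> v.kap a k" by (auto simp: T_def)
  ultimately show thesis using that[OF lin] level by blast
qed

text \<open>The levels are defined from the spaces and arrows alone, so an isomorphism matches them
  by transfinite induction; \<open>kap\<close> and the kernels follow.\<close>

lemma kaplansky_inv_eq_if_isomorphic: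
  assumes u: "cyclic_filtration r K n u" and v: "cyclic_filtration r K n v"
    and iso: "isomorphic_reps K n u v" and a: "a \<in> Field r" and k: "k < n"
  shows "kaplansky_inv K n u r k a =o kaplansky_inv K n v r k a"
proof -
  interpret u: cyclic_filtration r K n u by fact
  interpret v: cyclic_filtration r K n v by fact
  obtain \<phi> where \<phi>: "\<forall>k<n. linear_map K (u.U k) (v.U k) (\<phi> k) \<and>
      bij_betw (\<phi> k) (carrier (u.U k)) (carrier (v.U k)) \<and>
      (\<forall>x\<in>carrier (u.U k). v.f k (\<phi> k x) = \<phi> (u.nx k) (u.f k x))"
    using iso unfolding isomorphic_reps_def by blast
  have lin: "linear_map K (u.U k) (v.U k) (\<phi> k)"
    and inj: "inj_on (\<phi> k) (carrier (u.U k))" and surj: "\<phi> k ` carrier (u.U k) = carrier (v.U k)" if "k < n" for k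
    using \<phi> that unfolding bij_betw_def by auto
  have com: "v.f k (\<phi> k x) = \<phi> (u.nx k) (u.f k x)" if "k < n" "x \<in> carrier (u.U k)" for k x
    using \<phi> that by blast
  have level: "x \<in> u.A b k \<longleftrightarrow> \<phi> k x \<in> v.A b k" if "k < n" "x \<in> carrier (u.U k)" for b k x
    using that
  proof (induction b arbitrary: k x rule: u.filt_induct)
    case (1 b)
    have phi_x: "\<phi> k x \<in> carrier (v.U k)" using surj[OF 1(2)] 1(3) by blast
    show ?case
    proof (cases "underS r b = {}")
      case True
      then show ?thesis
        using filt_zero[OF u.Well_order True, of n u k] filt_zero[OF u.Well_order True, of n v k] 1(3) phi_x by simp
    next
      case False
      show ?thesis
      proof (cases "\<exists>c\<in>underS r b. b = u.S c")
        case True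
        then obtain c where c: "c \<in> underS r b" "b = u.S c" by blast
        then have cF: "c \<in> Field r" by (auto simp: underS_def Field_def)
        let ?j = "cprev n k"
        have j: "?j < n" "u.nx ?j = k" using u.cprev_less u.nx_cprev[OF 1(2)] by auto
        have eqs: "u.A b k = u.f ?j ` u.A c ?j" "v.A b k = v.f ?j ` v.A c ?j"
          unfolding c(2) by (rule u.filt_Suc'[OF cF 1(2)], rule v.filt_Suc'[OF cF 1(2)])
        show ?thesis
        proof
          assume "x \<in> u.A b k"
          then obtain w where w: "w \<in> u.A c ?j" "x = u.f ?j w" unfolding eqs by blast
          have wc: "w \<in> carrier (u.U ?j)" by (rule u.filt_carrier[OF j(1) w(1)])
          have "\<phi> k x = v.f ?j (\<phi> ?j w)" using com[OF j(1) wc] j(2) w(2) by simp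
          moreover have "\<phi> ?j w \<in> v.A c ?j" using 1(1)[OF c(1) j(1) wc] w(1) by simp
          ultimately show "\<phi> k x \<in> v.A b k" unfolding eqs by blast
        next
          \<comment> \<open>This direction needs bijectivity: \<open>z\<close> is pulled back by
            surjectivity at the preceding vertex, and injectivity at \<open>k\<close> identifies
            \<open>x\<close> with the image of the vector obtained.\<close>
          assume "\<phi> k x \<in> v.A b k"
          then obtain z where z: "z \<in> v.A c ?j" "\<phi> k x = v.f ?j z" unfolding eqs by blast
          have "z \<in> carrier (v.U ?j)" by (rule v.filt_carrier[OF j(1) z(1)])
          then obtain w where w: "w \<in> carrier (u.U ?j)" "z = \<phi> ?j w" using surj[OF j(1)] by blast
          have "\<phi> k x = \<phi> k (u.f ?j w)" using com[OF j(1) w(1)] z(2) w(2) j(2) by simp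
          moreover have "u.f ?j w \<in> carrier (u.U k)" using u.f_closed[OF j(1) w(1)] j(2) by simp
          ultimately have "x = u.f ?j w" using inj_onD[OF inj[OF 1(2)]] 1(3) by blast
          moreover have "w \<in> u.A c ?j" using 1(1)[OF c(1) j(1) w(1)] z(1) w(2) by simp
          ultimately show "x \<in> u.A b k" unfolding eqs by blast
        qed
      next
        case lim: False
        have "u.A b k = (\<Inter>c\<in>underS r b. u.A c k)" "v.A b k = (\<Inter>c\<in>underS r b. v.A c k)"
          by (rule filt_limit[OF u.Well_order False]; use lim in blast)+
        then show ?thesis using 1(1)[OF _ 1(2,3)] by auto
      qed
    qed
  qed
  have kap: "x \<in> u.kap a k \<longleftrightarrow> \<phi> k x \<in> v.kap a k" if x: "x \<in> carrier (u.U k)" for x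
    using level[OF k x, of a] level[OF u.nx_less u.f_closed[OF k x], of "u.S (u.S a)"] com[OF k x]
    by (simp add: u.kap_def v.kap_def)
  define Q where "Q = filt_quot n u r k a
      \<lparr>carrier := a_kernel (filt_quot n u r k a) (filt_quot n u r (u.nx k) (u.S a)) (induced_arrow n u r k a)\<rparr>"
  define R where "R = filt_quot n v r k a
      \<lparr>carrier := a_kernel (filt_quot n v r k a) (filt_quot n v r (u.nx k) (u.S a)) (induced_arrow n v r k a)\<rparr>"
  define p where "p = (\<lambda>x. u.A (u.S a) k +>\<^bsub>u.U k\<^esub> x)"
  define q where "q = (\<lambda>x. v.A (u.S a) k +>\<^bsub>v.U k\<^esub> x)"
  note Q = u.kaplansky_space[OF a k, folded Q_def p_def] and R = v.kaplansky_space[OF a k, folded R_def q_def]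
  interpret phi: linear_map K "u.U k" "v.U k" "\<phi> k" by (rule lin[OF k])
  interpret ku: submodule K "u.kap a k" "u.U k" by (rule Q(6))
  have kc: "x \<in> carrier (u.U k)" "\<phi> k x \<in> v.kap a k" if "x \<in> u.kap a k" for x
    using u.kap_carrier[OF k that] kap that by auto
  \<comment> \<open>Taken as a relation between cosets, the induced map calls for no choice of
    representatives; single-valuedness results from the condition on zero.\<close>
  define G where "G = {(p x, q (\<phi> k x)) | x. x \<in> u.kap a k}"
  have GI: "(p x, q (\<phi> k x)) \<in> G" if "x \<in> u.kap a k" for x using that unfolding G_def by blast
  have zero: "p x = \<zero>\<^bsub>Q\<^esub> \<longleftrightarrow> q (\<phi> k x) = \<zero>\<^bsub>R\<^esub>" if "x \<in> u.kap a k" for x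
    using Q(5)[OF that] R(5)[OF kc(2)[OF that]] level[OF k kc(1)[OF that]] by simp
  have "linear_relation K Q R G"
    unfolding linear_relation_def
  proof (intro conjI allI impI)
    show "G \<subseteq> carrier Q \<times> carrier R" unfolding G_def Q(2) R(2) using kc(2) by blast
    have "p \<zero>\<^bsub>u.U k\<^esub> = \<zero>\<^bsub>Q\<^esub>" using Q(5)[OF ku.zero_closed] u.filt_0[OF k] by blast
    then show "(\<zero>\<^bsub>Q\<^esub>, \<zero>\<^bsub>R\<^esub>) \<in> G" using GI[OF ku.zero_closed] zero[OF ku.zero_closed] by simp
  next
    fix X Y X' Y' assume "(X, Y) \<in> G" "(X', Y') \<in> G"
    then obtain x x' where x: "x \<in> u.kap a k" "x' \<in> u.kap a k"
      and X: "X = p x" "Y = q (\<phi> k x)" "X' = p x'" "Y' = q (\<phi> k x')" unfolding G_def by blast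
    show "(X \<oplus>\<^bsub>Q\<^esub> X', Y \<oplus>\<^bsub>R\<^esub> Y') \<in> G"
      using GI[OF ku.m_closed[OF x]] x kc by (simp add: X Q(3) R(3))
  next
    fix c X Y assume c: "c \<in> carrier K" and "(X, Y) \<in> G"
    then obtain x where x: "x \<in> u.kap a k" and X: "X = p x" "Y = q (\<phi> k x)" unfolding G_def by blast
    show "(c \<odot>\<^bsub>Q\<^esub> X, c \<odot>\<^bsub>R\<^esub> Y) \<in> G"
      using GI[OF ku.smult_closed[OF c x]] x c kc by (simp add: X Q(4) R(4))
  qed
  then have "\<exists>T. linear_map K Q R T \<and> bij_betw T (carrier Q) (carrier R)"
  proof (rule linear_relation_bij[OF Q(1) R(1)])
    show "\<exists>Y. (X, Y) \<in> G" if "X \<in> carrier Q" for X using that GI unfolding Q(2) by blast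
    show "\<exists>X. (X, Y) \<in> G" if Y: "Y \<in> carrier R" for Y
    proof -
      obtain y where y: "y \<in> v.kap a k" "Y = q y" using Y unfolding R(2) by blast
      then have "y \<in> carrier (v.U k)" using v.kap_carrier[OF k] by blast
      then obtain x where x: "x \<in> carrier (u.U k)" "y = \<phi> k x" using surj[OF k] by blast
      then have "x \<in> u.kap a k" using kap y(1) by simp
      then show ?thesis using GI x(2) y(2) by blast
    qed
    show "X = \<zero>\<^bsub>Q\<^esub> \<longleftrightarrow> Y = \<zero>\<^bsub>R\<^esub>" if "(X, Y) \<in> G" for X Y
      using that zero unfolding G_def by blast
  qed blast
  then have "vdim K Q =o vdim K R" using vdim_ordIso_iff[OF Q(1) R(1)] by blast
  then show ?thesis unfolding kaplansky_inv_def Q_def R_def .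
qed

section \<open>Countable dimension\<close>

context cyclic_filtration
begin

text \<open>Adjoining one vector adds at most one height: up to a nonzero scalar, the elements
  outside the old span lie in a single coset of it.\<close>

lemma finite_jumps_span:
  assumes k: "k < n" and "finite X" "X \<subseteq> carrier (U k)"
  shows "finite (jumps k (module.span K (U k) X))"
  using assms(2,3)
proof (induction X rule: finite_induct)
  case empty
  interpret vectorspace K "U k" by (rule vs[OF k])
  have "jumps k (span {}) = {}" unfolding jumps_def span_empty using filt_0[OF k] by blast
  then show ?case by simp
next
  case (insert x X)
  interpret vectorspace K "U k" by (rule vs[OF k])
  have xc: "x \<in> carrier (U k)" and Xc: "X \<subseteq> carrier (U k)" using insert.prems by auto
  note sub = span_is_submodule[OF Xc]
  interpret D: submodule K "span X" "U k" by (rule sub)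
  let ?C = "(\<lambda>s. x \<oplus>\<^bsub>U k\<^esub> s) ` span X"
  have "jumps k (span (insert x X)) \<subseteq> jumps k (span X) \<union> jumps k ?C"
  proof
    fix a assume "a \<in> jumps k (span (insert x X))"
    then obtain z where a: "a \<in> Field r" and z: "z \<in> span (insert x X)" and za: "z \<in> A a k" "z \<notin> A (S a) k"
      unfolding jumps_def by blast
    obtain c where c: "c \<in> insert x X \<rightarrow> carrier K" "z = lincomb c (insert x X)"
      using z finite_span[of "insert x X"] insert.hyps(1) insert.prems by auto
    have cx: "c x \<in> carrier K" and cX: "c \<in> X \<rightarrow> carrier K" using c(1) by auto
    let ?s = "lincomb c X"
    have s: "?s \<in> span X" using cX insert.hyps(1) unfolding span_def by blast
    then have sc: "?s \<in> carrier (U k)" using D.subset by blast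
    have zs: "z = c x \<odot>\<^bsub>U k\<^esub> x \<oplus>\<^bsub>U k\<^esub> ?s"
      unfolding c(2) by (rule lincomb_insert2[OF insert.hyps(1) Xc c(1) insert.hyps(2) xc])
    show "a \<in> jumps k (span X) \<union> jumps k ?C"
    proof (cases "c x = \<zero>\<^bsub>K\<^esub>")
      case True
      then have "z = ?s" using zs xc sc by simp
      then show ?thesis using a s za unfolding jumps_def by blast
    next
      case False
      let ?t = "inv\<^bsub>K\<^esub> c x \<odot>\<^bsub>U k\<^esub> ?s"
      note iv = smult_inverse[OF cx False sc]
      have t: "?t \<in> span X" by (rule D.smult_closed[OF iv(1) s])
      have xt: "x \<oplus>\<^bsub>U k\<^esub> ?t \<in> carrier (U k)" using xc t D.subset by blast
      have "z = c x \<odot>\<^bsub>U k\<^esub> (x \<oplus>\<^bsub>U k\<^esub> ?t)"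
        using zs iv xc sc cx by (simp add: smult_r_distr)
      then have "x \<oplus>\<^bsub>U k\<^esub> ?t \<in> A a k" "x \<oplus>\<^bsub>U k\<^esub> ?t \<notin> A (S a) k"
        using za filt_smult_iff[OF k cx False xt] by simp_all
      then show ?thesis using a t unfolding jumps_def by blast
    qed
  qed
  moreover have "finite (jumps k ?C)"
    by (rule finite_jumps_coset[OF k D.subset submodule_minus_closed[OF sub] xc insert.IH[OF Xc]])
  ultimately show ?case using insert.IH[OF Xc] finite_subset by blast
qed

text \<open>Every vector is in the span of one of the countably many finite subsets of the basis,
  and each such span has finitely many heights. This works although the set of vectors may be
  uncountable.\<close>

lemma countable_jumps:
  assumes k: "k < n" and B: "countable B" "vectorspace.basis K (U k) B"
  shows "countable (jumps k (carrier (U k)))"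
proof -
  interpret vectorspace K "U k" by (rule vs[OF k])
  have Bc: "B \<subseteq> carrier (U k)" "span B = carrier (U k)" using B(2) unfolding basis_def by auto
  have "jumps k (carrier (U k)) \<subseteq> (\<Union>X\<in>{X. finite X \<and> X \<subseteq> B}. jumps k (span X))"
  proof
    fix a assume "a \<in> jumps k (carrier (U k))"
    then obtain x where a: "a \<in> Field r" and x: "x \<in> span B" "x \<in> A a k" "x \<notin> A (S a) k"
      unfolding jumps_def Bc(2)[symmetric] by blast
    obtain X c where X: "finite X" "X \<subseteq> B" "c \<in> X \<rightarrow> carrier K" "x = lincomb c X"
      using x(1) unfolding span_def by blast
    then have "x \<in> span X" unfolding span_def by blast
    then show "a \<in> (\<Union>X\<in>{X. finite X \<and> X \<subseteq> B}. jumps k (span X))"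
      using X(1,2) a x(2,3) unfolding jumps_def by blast
  qed
  moreover have "countable (jumps k (span X))" if "finite X" "X \<subseteq> B" for X
    using finite_jumps_span[OF k that(1)] that(2) Bc(1) by (simp add: countable_finite)
  then have "countable (\<Union>X\<in>{X. finite X \<and> X \<subseteq> B}. jumps k (span X))"
    by (intro countable_UN countable_Collect_finite_subset B(1)) blast
  ultimately show ?thesis using countable_subset by blast
qed

text \<open>Countably many heights cannot exhaust the uncountable field of \<open>r\<close>, so some
  \<open>a\<close> is a height at no vertex. There the filtration is stationary at all vertices
  simultaneously, and a family that the arrows map onto itself lies in every level, hence in
  \<open>filt_inf\<close>.\<close>

lemma filt_separated:
  assumes unc: "uncountable (Field r)" and red: "reduced_rep n u"
    and B: "\<And>k. k < n \<Longrightarrow> countable (B k) \<and> vectorspace.basis K (U k) (B k)"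
    and k: "k < n" and x: "\<And>a. x \<in> A a k"
  shows "x = \<zero>\<^bsub>U k\<^esub>"
proof -
  have "countable (\<Union>k\<in>{..<n}. jumps k (carrier (U k)))"
    using countable_jumps B by (intro countable_UN) auto
  then have "\<not> Field r \<subseteq> (\<Union>k\<in>{..<n}. jumps k (carrier (U k)))" using unc countable_subset by blast
  then obtain a where a: "a \<in> Field r" "\<And>k. k < n \<Longrightarrow> a \<notin> jumps k (carrier (U k))" by blast
  have stat: "A (S a) k = A a k" if "k < n" for k
  proof
    show "A (S a) k \<subseteq> A a k" by (rule filt_Suc_subset[OF a(1) that])
    show "A a k \<subseteq> A (S a) k" using a filt_carrier[OF that] that unfolding jumps_def by blast
  qed
  \<comment> \<open>Induction over \<open>r'\<close> alone: the stationary family survives each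
    step, so \<open>r\<close> and \<open>r'\<close> never have to be compared as orders.\<close>
  have below: "A a k \<subseteq> filt n u r' b k" if r': "Well_order r'" and "k < n" for r' :: "(nat \<times> 'a) set rel" and b k
    using \<open>k < n\<close>
  proof (induction b arbitrary: k rule: wo_rel.well_order_induct[of r'])
    case 1
    then show ?case using r' by (simp add: wo_rel_def)
  next
    case (2 b)
    have IH: "A a k \<subseteq> filt n u r' c k" if "c \<in> underS r' b" "k < n" for c k
      using 2 that by (auto simp: underS_def)
    show ?case
    proof (rule filt_cases[OF r', of b n u])
      assume "\<And>k. filt n u r' b k = carrier (U k)"
      then show ?thesis using filt_carrier[OF 2(2)] by blast
    next
      fix c assume c: "c \<in> underS r' b" and eq: "\<And>k. filt n u r' b k = f (cprev n k) ` filt n u r' c (cprev n k)"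
      have "A a k = f (cprev n k) ` A a (cprev n k)"
        using filt_Suc'[OF a(1) 2(2)] stat[OF 2(2)] by simp
      then show ?thesis unfolding eq[of k] using IH[OF c cprev_less] by blast
    next
      assume "\<And>k. filt n u r' b k = (\<Inter>c\<in>underS r' b. filt n u r' c k)"
      then show ?thesis using IH[OF _ 2(2)] by blast
    qed
  qed
  have "x \<in> filt_inf n u k" unfolding filt_inf_def using below[OF _ k] x[of a] by blast
  then show ?thesis using red k unfolding reduced_rep_def by blast
qed

end

lemma countable_basis_if_rep_dim:
  assumes rep: "cyclic_rep K n u" and dim: "rep_dim K n u \<le>o natLeq"
  shows "\<exists>B. \<forall>k<n. countable (B k) \<and> vectorspace.basis K (space_at u k) (B k)"
proof -
  \<comment> \<open>The same choice as in \<open>vdim\<close>, so that \<open>rep_dim\<close> is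
    literally the cardinality of the disjoint union of these bases.\<close>
  define B where "B k = (SOME B. vectorspace.basis K (space_at u k) B)" for k
  have "rep_dim K n u = |SIGMA k : {..<n}. B k|"
    unfolding rep_dim_def vdim_def B_def by (rule SIGMA_CSUM[symmetric])
  then have "countable (SIGMA k : {..<n}. B k)" using dim countable_card_le_natLeq by metis
  moreover have "B k \<subseteq> snd ` (SIGMA k : {..<n}. B k)" if "k < n" for k using that by force
  ultimately have "countable (B k)" if "k < n" for k using that countable_subset countable_image by metis
  moreover have "vectorspace.basis K (space_at u k) (B k)" if "k < n" for k
  proof -
    interpret vectorspace K "space_at u k" using rep that by (simp add: cyclic_rep_def)
    show ?thesis unfolding B_def using basis_exists by (rule someI_ex)
  qed
  ultimately show ?thesis by blast
qed

section \<open>The first uncountable ordinal as index set\<close>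

lemma Card_order_omega1: "Card_order omega1"
  unfolding omega1_def by (rule cardSuc_Card_order[OF natLeq_Card_order])

lemma uncountable_Field_omega1: "uncountable (Field omega1)"
proof
  assume "countable (Field omega1)"
  then have "|Field omega1| \<le>o natLeq" by (simp only: countable_card_le_natLeq)
  then have "omega1 \<le>o natLeq"
    using card_of_Field_ordIso[OF Card_order_omega1] ordIso_symmetric ordIso_ordLeq_trans by blast
  moreover have "natLeq <o omega1" unfolding omega1_def by (rule cardSuc_greater[OF natLeq_Card_order])
  ultimately show False using not_ordLess_ordLeq by blast
qed

lemma limit_order_omega1: "limit_order omega1"
proof
  show "Well_order omega1" using Card_order_omega1 by (simp add: card_order_on_def)
  have inf: "infinite (Field omega1)" using uncountable_Field_omega1 countable_finite by blast
  show "\<exists>b. b \<noteq> a \<and> (a, b) \<in> omega1" if "a \<in> Field omega1" for a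
    using infinite_Card_order_limit[OF Card_order_omega1 inf that] by blast
qed

theorem theorem1p8:
  fixes F :: "('f, 'm) ring_scheme" and n :: nat
    and u :: "('f, 'a) cyc_rep" and v :: "('f, 'b) cyc_rep"
  assumes "field F" and "0 < n"
    and "cyclic_rep F n u" and "cyclic_rep F n v"
    and "reduced_rep n u" and "reduced_rep n v"
    and "locally_nilpotent n u" and "locally_nilpotent n v"
    and "rep_dim F n u \<le>o natLeq" and "rep_dim F n v \<le>o natLeq"
  shows "isomorphic_reps F n u v \<longleftrightarrow>
    (\<forall>k<n. \<forall>\<alpha>\<in>Field omega1.
       kaplansky_inv F n u omega1 k \<alpha> =o kaplansky_inv F n v omega1 k \<alpha>)"
proof (intro iffI allI ballI impI)
  have u: "cyclic_filtration omega1 F n u" and v: "cyclic_filtration omega1 F n v"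
    using assms(2-4) limit_order_omega1 by (simp_all add: cyclic_filtration_def cyclic_filtration_axioms_def)
  show "kaplansky_inv F n u omega1 k \<alpha> =o kaplansky_inv F n v omega1 k \<alpha>"
    if "isomorphic_reps F n u v" "k < n" "\<alpha> \<in> Field omega1" for k \<alpha>
    by (rule kaplansky_inv_eq_if_isomorphic[OF u v that(1,3,2)])
  assume eq: "\<forall>k<n. \<forall>\<alpha>\<in>Field omega1. kaplansky_inv F n u omega1 k \<alpha> =o kaplansky_inv F n v omega1 k \<alpha>"
  interpret u: cyclic_filtration omega1 F n u by (rule u)
  interpret v: cyclic_filtration omega1 F n v by (rule v)
  obtain B where B: "\<forall>k<n. countable (B k) \<and> vectorspace.basis F (u.U k) (B k)"
    using countable_basis_if_rep_dim[OF assms(3,9)] ..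
  obtain C where C: "\<forall>k<n. countable (C k) \<and> vectorspace.basis F (v.U k) (C k)"
    using countable_basis_if_rep_dim[OF assms(4,10)] ..
  \<comment> \<open>Collects what \<open>theta_exists\<close> provides, so that a single choice
    yields \<open>\<Theta>\<close> for all levels and vertices.\<close>
  define good where "good a k T \<longleftrightarrow> linear_relation F (u.U k) (v.U k) T \<and> T \<subseteq> u.kap a k \<times> v.kap a k \<and>
      u.kap a k \<subseteq> Domain T \<and> v.kap a k \<subseteq> Range T \<and>
      (\<forall>x y. (x, y) \<in> T \<longrightarrow> x \<in> u.A (u.S a) k \<longleftrightarrow> y \<in> v.A (u.S a) k) \<and>
      u.A (u.S a) k \<times> v.A (u.S a) k \<subseteq> T" for a k T
  have "\<exists>T. good a k T" if "a \<in> Field omega1" "k < n" for a k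
    by (rule theta_exists[OF u v that]) (use eq that in \<open>auto simp: good_def\<close>)
  then obtain \<Theta> where \<Theta>: "\<And>a k. a \<in> Field omega1 \<Longrightarrow> k < n \<Longrightarrow> good a k (\<Theta> a k)" by metis
  interpret filtration_pair omega1 F n u v \<Theta>
  proof
    fix a k assume ak: "a \<in> Field omega1" "k < n"
    note T = \<Theta>[OF ak, unfolded good_def]
    show "linear_relation F (u.U k) (v.U k) (\<Theta> a k)" using T by blast
    show "x \<in> u.kap a k \<and> y \<in> v.kap a k" if "(x, y) \<in> \<Theta> a k" for x y using T that by blast
    show "\<exists>y. (x, y) \<in> \<Theta> a k" if "x \<in> u.kap a k" for x using T that by blast
    show "\<exists>x. (x, y) \<in> \<Theta> a k" if "y \<in> v.kap a k" for y using T that by blast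
    show "x \<in> u.A (u.S a) k \<longleftrightarrow> y \<in> v.A (u.S a) k" if "(x, y) \<in> \<Theta> a k" for x y using T that by blast
    show "(x, y) \<in> \<Theta> a k" if "x \<in> u.A (u.S a) k" "y \<in> v.A (u.S a) k" for x y using T that by blast
  next
    fix k assume k: "k < n"
    show "x = \<zero>\<^bsub>u.U k\<^esub>" if "\<And>a. x \<in> u.A a k" for x
      by (rule u.filt_separated[OF uncountable_Field_omega1 assms(5) B[rule_format] k that])
    show "y = \<zero>\<^bsub>v.U k\<^esub>" if "\<And>a. y \<in> v.A a k" for y
      by (rule v.filt_separated[OF uncountable_Field_omega1 assms(6) C[rule_format] k that])
  qed
  show "isomorphic_reps F n u v" by (rule isomorphic_if_countable[OF B[rule_format] C[rule_format] assms(7,8)])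
qed

end
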